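(* Let $A,H$ be self-adjoint operators on a Hilbert space $\mathcal{H}$ with $H$ of class $C^1(A)$ and $H'=cH$ for some $c\in\mathbb{R}\setminus\{0\}$, where $H'=[H,\mathrm{i}A]$. Let $u\in D(A)$ be such that $u,Au\in\mathcal{E}(H)$. Then there is a constant $C_u$ such that $|\psi_u(t)|\le C_u\langle t\rangle^{-1/2}$ for all $t\in\mathbb{R}$, where $\psi_u(t)=\langle u,\mathrm{e}^{\mathrm{i}tH}u\rangle$.
   Context: Notation: $\langle t\rangle=(1+t^2)^{1/2}$. A bounded operator $S$ on $\mathcal{H}$ is of class $C^1(A)$ if the sesquilinear form $(u,v)\mapsto\langle Au,Sv\rangle-\langle u,SAv\rangle$ on $D(A)$ is continuous for the topology induced by $\mathcal{H}$. A self-adjoint operator $H$ is of class $C^1(A)$ if $(H-z)^{-1}$ is of class $C^1(A)$ for some (hence all) $z$ in the resolvent set of $H$. In that case $D(A)\cap D(H)$ is dense in $D(H)$ (graph topology) and the form $[A,H](u,v)=\langle Au,Hv\rangle-\langle Hu,Av\rangle$ on $D(A)\cap D(H)$ extends uniquely to a continuous sesquilinear form $[A,H]$ on $D(H)$, identified with a continuous operator $D(H)\to D(H)^*$ (where $D(H)\subset\mathcal{H}\subset D(H)^*$). One sets $[H,A]=-[A,H]$ and $H'=[H,\mathrm{i}A]=\mathrm{i}[H,A]$. The equality $H'=cH$ is an equality of forms on $D(H)$. The subspace $\mathcal{E}(H)$ is the set of $u\in\mathcal{H}$ such that $\int_{\mathbb{R}}|\langle u,\mathrm{e}^{\mathrm{i}tH}u\rangle|^2\,dt<\infty$.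 *)

theory Defs
  imports "HOL-Analysis.Analysis"
begin

section \<open>Complex Hilbert spaces\<close>

text \<open>
  The inner product is antilinear in its first and linear in its second argument. The norm, metric
  and topology are inherited from the underlying real inner product, which is the real part of the
  complex one; in particular, \<open>cinner x x = (norm x)\<^sup>2\<close>.
\<close>

class complex_inner = real_inner +
  fixes scaleC :: "complex \<Rightarrow> 'a \<Rightarrow> 'a" (infixr "*\<^sub>C" 75)
    and cinner :: "'a \<Rightarrow> 'a \<Rightarrow> complex"
  assumes scaleC_add_right: "a *\<^sub>C (x + y) = a *\<^sub>C x + a *\<^sub>C y"
    and scaleC_add_left: "(a + b) *\<^sub>C x = a *\<^sub>C x + b *\<^sub>C x"
    and scaleC_scaleC: "a *\<^sub>C (b *\<^sub>C x) = (a * b) *\<^sub>C x"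
    and scaleR_scaleC: "r *\<^sub>R x = complex_of_real r *\<^sub>C x"
    and cinner_commute: "cinner x y = cnj (cinner y x)"
    and cinner_add_right: "cinner x (y + z) = cinner x y + cinner x z"
    and cinner_scaleC_right: "cinner x (a *\<^sub>C y) = a * cinner x y"
    and inner_eq_Re_cinner: "inner x y = Re (cinner x y)"

class complex_hilbert = complex_inner + complete_space

section \<open>Unbounded operators\<close>

text \<open>
  An operator is a domain together with a map. The values of the map outside the domain are
  irrelevant: everything below depends only on the graph.
\<close>

record 'a unbounded_op =
  dom_op :: "'a set"
  app :: "'a \<Rightarrow> 'a"

definition linear_op :: "'a::complex_inner unbounded_op \<Rightarrow> bool" where
  "linear_op A \<longleftrightarrow> 0 \<in> dom_op A
     \<and> (\<forall>u\<in>dom_op A. \<forall>v\<in>dom_op A. u + v \<in> dom_op A \<and> app A (u + v) = app A u + app A v)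
     \<and> (\<forall>a. \<forall>u\<in>dom_op A. a *\<^sub>C u \<in> dom_op A \<and> app A (a *\<^sub>C u) = a *\<^sub>C app A u)"

definition op_graph :: "'a unbounded_op \<Rightarrow> ('a \<times> 'a) set" where
  "op_graph A = {(u, app A u) | u. u \<in> dom_op A}"

definition adjoint_graph :: "'a::complex_inner unbounded_op \<Rightarrow> ('a \<times> 'a) set" where
  "adjoint_graph A = {(v, w). \<forall>u\<in>dom_op A. cinner (app A u) v = cinner u w}"

definition self_adjoint :: "'a::complex_inner unbounded_op \<Rightarrow> bool" where
  "self_adjoint A \<longleftrightarrow>
     linear_op A \<and> closure (dom_op A) = UNIV \<and> adjoint_graph A = op_graph A"

definition bounded_op :: "('a::complex_inner \<Rightarrow> 'a) \<Rightarrow> bool" where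
  "bounded_op S \<longleftrightarrow> bounded_linear S \<and> (\<forall>a u. S (a *\<^sub>C u) = a *\<^sub>C S u)"

definition resolvent :: "'a::complex_inner unbounded_op \<Rightarrow> complex \<Rightarrow> 'a \<Rightarrow> 'a" where
  "resolvent H z = inv_into (dom_op H) (\<lambda>u. app H u - z *\<^sub>C u)"

definition resolvent_set :: "'a::complex_inner unbounded_op \<Rightarrow> complex set" where
  "resolvent_set H =
     {z. bij_betw (\<lambda>u. app H u - z *\<^sub>C u) (dom_op H) UNIV \<and> bounded_op (resolvent H z)}"

section \<open>The class \<open>C\<^sup>1(A)\<close> and the commutator form\<close>

definition C1_bounded :: "'a::complex_inner unbounded_op \<Rightarrow> ('a \<Rightarrow> 'a) \<Rightarrow> bool" where
  "C1_bounded A S \<longleftrightarrow> bounded_op S \<and>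
     continuous_on (dom_op A \<times> dom_op A)
       (\<lambda>(u, v). cinner (app A u) (S v) - cinner u (S (app A v)))"

definition C1_self_adjoint :: "'a::complex_inner unbounded_op \<Rightarrow> 'a unbounded_op \<Rightarrow> bool" where
  "C1_self_adjoint A H \<longleftrightarrow> (\<exists>z\<in>resolvent_set H. C1_bounded A (resolvent H z))"

definition sesquilinear_on :: "'a::complex_inner set \<Rightarrow> ('a \<Rightarrow> 'a \<Rightarrow> complex) \<Rightarrow> bool" where
  "sesquilinear_on D F \<longleftrightarrow>
     (\<forall>u\<in>D. \<forall>v\<in>D. \<forall>w\<in>D. F (u + v) w = F u w + F v w \<and> F u (v + w) = F u v + F u w)
     \<and> (\<forall>a. \<forall>u\<in>D. \<forall>v\<in>D. F (a *\<^sub>C u) v = cnj a * F u v \<and> F u (a *\<^sub>C v) = a * F u v)"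

text \<open>
  The graph topology on the domain of \<open>H\<close> is the topology of the graph of \<open>H\<close> as a subspace of the
  product space, transported along \<open>u \<mapsto> (u, H u)\<close>.
\<close>

definition graph_continuous_form ::
    "'a::complex_inner unbounded_op \<Rightarrow> ('a \<Rightarrow> 'a \<Rightarrow> complex) \<Rightarrow> bool" where
  "graph_continuous_form H F \<longleftrightarrow>
     continuous_on (op_graph H \<times> op_graph H) (\<lambda>((u, _), (v, _)). F u v)"

text \<open>
  The form \<open>[A, H]\<close>: the unique continuous sesquilinear extension to the domain of \<open>H\<close>. Forms are
  total functions here, so the value \<open>0\<close> is prescribed off the domain to make the extension unique
  as a function.
\<close>

definition commutator_form ::
    "'a::complex_inner unbounded_op \<Rightarrow> 'a unbounded_op \<Rightarrow> 'a \<Rightarrow> 'a \<Rightarrow> complex" where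
  "commutator_form A H = (THE F.
     sesquilinear_on (dom_op H) F \<and> graph_continuous_form H F
     \<and> (\<forall>u\<in>dom_op A \<inter> dom_op H. \<forall>v\<in>dom_op A \<inter> dom_op H.
          F u v = cinner (app A u) (app H v) - cinner (app H u) (app A v))
     \<and> (\<forall>u v. u \<notin> dom_op H \<or> v \<notin> dom_op H \<longrightarrow> F u v = 0))"

text \<open>\<open>H' = [H, \<i>A] = \<i>[H, A]\<close>, where \<open>[H, A] = - [A, H]\<close>\<close>

definition H_prime ::
    "'a::complex_inner unbounded_op \<Rightarrow> 'a unbounded_op \<Rightarrow> 'a \<Rightarrow> 'a \<Rightarrow> complex" where
  "H_prime A H u v = \<i> * (- commutator_form A H u v)"

section \<open>The unitary group\<close>

definition unitary :: "('a::complex_inner \<Rightarrow> 'a) \<Rightarrow> bool" where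
  "unitary U \<longleftrightarrow> bounded_op U \<and> surj U \<and> (\<forall>u v. cinner (U u) (U v) = cinner u v)"

definition unitary_group :: "(real \<Rightarrow> 'a::complex_inner \<Rightarrow> 'a) \<Rightarrow> bool" where
  "unitary_group U \<longleftrightarrow> (\<forall>t. unitary (U t)) \<and> U 0 = id \<and> (\<forall>s t. U (s + t) = U s \<circ> U t)
     \<and> (\<forall>u. continuous_on UNIV (\<lambda>t. U t u))"

text \<open>
  For self-adjoint \<open>H\<close>, \<open>exp_i H t\<close> is the operator \<open>e\<^sup>i\<^sup>t\<^sup>H\<close>, obtained as the strongly continuous
  unitary group whose infinitesimal generator is exactly \<open>\<i>H\<close>, domain included (existence and
  uniqueness are Stone's theorem).
\<close>

definition exp_i :: "'a::complex_inner unbounded_op \<Rightarrow> real \<Rightarrow> 'a \<Rightarrow> 'a" where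
  "exp_i H = (THE U. unitary_group U \<and>
     {(u, w). ((\<lambda>t. U t u) has_vector_derivative \<i> *\<^sub>C w) (at 0)} = op_graph H)"

definition psi :: "'a::complex_inner unbounded_op \<Rightarrow> 'a \<Rightarrow> real \<Rightarrow> complex" where
  "psi H u t = cinner u (exp_i H t u)"

definition E_space :: "'a::complex_inner unbounded_op \<Rightarrow> 'a set" where
  "E_space H = {u. (\<integral>\<^sup>+ t. ennreal ((cmod (psi H u t))\<^sup>2) \<partial>lborel) < \<infinity>}"

definition japanese_bracket :: "real \<Rightarrow> real" where
  "japanese_bracket t = (1 + t\<^sup>2) powr (1/2)"

end

theory Submission
  imports Defs
begin

text \<open>
  From \<open>H' = cH\<close> one gets \<open>[A, e\<^sup>i\<^sup>t\<^sup>H] = - c t H e\<^sup>i\<^sup>t\<^sup>H\<close>, hence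
  \<open>t \<psi>\<^sub>u'(t) = - (\<i> / c) (\<langle>Au, e\<^sup>i\<^sup>t\<^sup>H u\<rangle> - \<langle>u, e\<^sup>i\<^sup>t\<^sup>H Au\<rangle>)\<close>. Since \<open>u\<close> and \<open>Au\<close> lie in
  \<open>\<E>(H)\<close>, both \<open>\<psi>\<^sub>u\<close> and \<open>t \<psi>\<^sub>u'\<close> are square integrable, so
  \<open>t |\<psi>\<^sub>u(t)|\<^sup>2 = \<integral>\<^sub>0\<^sup>t (|\<psi>\<^sub>u|\<^sup>2 + 2 Re (\<psi>\<^sub>u\<^sup>* s \<psi>\<^sub>u')) ds\<close> stays bounded.

  No spectral theorem is used. The group is the limit of \<open>(1 - \<i>tH/n)\<^sup>-\<^sup>n\<close> along the powers of two,
  and the commutator formula is first proved for the resolvents \<open>(1 - \<i>hH)\<^sup>-\<^sup>1\<close>. The square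
  integrability of \<open>\<langle>f, e\<^sup>i\<^sup>t\<^sup>H g\<rangle>\<close> for \<open>f, g \<in> \<E>(H)\<close> follows from the positivity of the entrywise
  square of the Gram matrix of the vectors \<open>e\<^sup>i\<^sup>s\<^sup>H f\<close> and \<open>e\<^sup>i\<^sup>s\<^sup>H g\<close>, with \<open>s\<close> on a grid in \<open>[0, T]\<close>.
\<close>

section \<open>Complex Hilbert spaces and bounded operators\<close>

text \<open>The obstacle is one of domains. The hypothesis, which reads
  \<open>[A, H] = \<i>cH\<close>, is an identity of forms on \<open>dom_op H\<close>, while
  \<open>u\<close> may lie outside \<open>dom_op H\<close>, so that \<open>\<psi>\<close> need not
  be differentiable. The class C1 supplies one resolvent of \<open>H\<close> with a bounded
  commutator; the other commutators follow from it by algebra with the bounded operators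
  \<open>A (1 - \<i>hA)^-1\<close>, and closedness of \<open>A\<close> recovers domain and value in
  the limit. Likewise \<open>u\<close> is approximated by \<open>(1 - \<i>hH)^-1 u\<close>; the
  final estimate survives because it contains \<open>u\<close> and \<open>Au\<close>, but not
  \<open>Hu\<close>. Spectrally, a vector of \<open>\<E>(H)\<close> has a square integrable spectral
  density, and a mixed density is at most the geometric mean of the pure ones. Schur's theorem
  replaces this comparison: signs \<open>+1\<close> on the orbit of \<open>f\<close> and
  \<open>-1\<close> on that of \<open>g\<close> bound the mixed double sum by the average of the
  pure ones. In the limit of fine grids the weight \<open>1 - r/T\<close> appears, which a window of
  double length removes.\<close>

lemma cinner_add_left: "cinner (x + y) z = cinner x z + cinner (y::'a::complex_inner) z"
  by (metis cinner_add_right cinner_commute complex_cnj_add)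

lemma cinner_scaleC_left: "cinner (a *\<^sub>C x) y = cnj a * cinner x (y::'a::complex_inner)"
  by (metis cinner_commute cinner_scaleC_right complex_cnj_mult)

lemma scaleC_eq_scaleR: "complex_of_real r *\<^sub>C x = r *\<^sub>R (x::'a::complex_inner)"
  by (simp add: scaleR_scaleC)

lemma scaleC_one [simp]: "1 *\<^sub>C x = (x::'a::complex_inner)"
  using scaleC_eq_scaleR [of 1 x] by simp

lemma scaleC_zero_left [simp]: "0 *\<^sub>C x = (0::'a::complex_inner)"
  using scaleC_eq_scaleR [of 0 x] by simp

lemma scaleC_zero_right [simp]: "a *\<^sub>C 0 = (0::'a::complex_inner)"
  using scaleC_add_right [of a 0 0] by simp

lemma scaleC_minus_right [simp]: "a *\<^sub>C (- x) = - (a *\<^sub>C (x::'a::complex_inner))"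
  by (metis add.right_inverse add_eq_0_iff scaleC_add_right scaleC_zero_right)

lemma scaleC_minus_left [simp]: "(- a) *\<^sub>C x = - (a *\<^sub>C (x::'a::complex_inner))"
  by (metis add.right_inverse add_eq_0_iff scaleC_add_left scaleC_zero_left)

lemma scaleC_diff_right: "a *\<^sub>C (x - y) = a *\<^sub>C x - a *\<^sub>C (y::'a::complex_inner)"
  using scaleC_add_right [of a x "- y"] by simp

lemma scaleC_diff_left: "(a - b) *\<^sub>C x = a *\<^sub>C x - b *\<^sub>C (x::'a::complex_inner)"
  using scaleC_add_left [of a "- b" x] by simp

lemma cinner_zero_right [simp]: "cinner x 0 = (0::complex)"
  using cinner_scaleC_right [of x 0 "0::'a::complex_inner"] by simp

lemma cinner_zero_left [simp]: "cinner 0 x = (0::complex)"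
  using cinner_scaleC_left [of 0 "0::'a::complex_inner"] by simp

lemma cinner_minus_right [simp]: "cinner x (- y) = - cinner x (y::'a::complex_inner)"
  using cinner_scaleC_right [of x "-1" y] by simp

lemma cinner_minus_left [simp]: "cinner (- x) y = - cinner x (y::'a::complex_inner)"
  using cinner_scaleC_left [of "-1" x y] by simp

lemma cinner_diff_right: "cinner x (y - z) = cinner x y - cinner x (z::'a::complex_inner)"
  using cinner_add_right [of x y "- z"] by simp

lemma cinner_diff_left: "cinner (x - y) z = cinner x z - cinner y (z::'a::complex_inner)"
  using cinner_add_left [of x "- y" z] by simp

lemma cinner_self: "cinner x x = complex_of_real ((norm (x::'a::complex_inner))\<^sup>2)"
proof -
  have "Im (cinner x x) = 0"
    using cinner_commute [of x x] by (metis Reals_cnj_iff complex_is_Real_iff)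
  then show ?thesis
    by (simp add: complex_eq_iff power2_norm_eq_inner inner_eq_Re_cinner)
qed

lemma norm_scaleC [simp]: "norm (a *\<^sub>C x) = cmod a * norm (x::'a::complex_inner)"
proof -
  have "complex_of_real ((norm (a *\<^sub>C x))\<^sup>2) = cinner (a *\<^sub>C x) (a *\<^sub>C x)"
    by (rule cinner_self [symmetric])
  also have "\<dots> = cnj a * a * cinner x x"
    by (simp add: cinner_scaleC_left cinner_scaleC_right)
  also have "\<dots> = complex_of_real ((cmod a * norm x)\<^sup>2)"
    by (simp add: cinner_self power_mult_distrib mult.commute [of "cnj a"]
        complex_norm_square [symmetric])
  finally have "(norm (a *\<^sub>C x))\<^sup>2 = (cmod a * norm x)\<^sup>2"
    using of_real_eq_iff by blast
  then show ?thesis by (simp add: power2_eq_iff_nonneg)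
qed

lemma cmod_cinner_le: "cmod (cinner x y) \<le> norm x * norm (y::'a::complex_inner)"
proof (cases "cinner x y = 0")
  case False
  \<comment> \<open>A phase that rotates the complex inner product onto the positive axis, so that
    the real Cauchy-Schwarz inequality applies.\<close>
  define a where "a = cnj (cinner x y) / complex_of_real (cmod (cinner x y))"
  have a: "cmod a = 1" using False by (simp add: a_def norm_divide)
  have "a * cinner x y = complex_of_real (cmod (cinner x y))"
    using False complex_norm_square [of "cinner x y"]
    by (simp add: a_def power2_eq_square divide_eq_eq mult.commute)
  then have "cmod (cinner x y) = inner x (a *\<^sub>C y)"
    by (metis Re_complex_of_real cinner_scaleC_right inner_eq_Re_cinner)
  also have "\<dots> \<le> norm x * norm (a *\<^sub>C y)" by (rule norm_cauchy_schwarz)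
  finally show ?thesis using a by simp
qed auto

lemma bounded_bilinear_cinner: "bounded_bilinear (cinner :: 'a::complex_inner \<Rightarrow> 'a \<Rightarrow> complex)"
proof
  show "\<exists>K. \<forall>a b. cmod (cinner (a::'a) b) \<le> norm a * norm b * K"
    by (rule exI [of _ 1]) (use cmod_cinner_le in auto)
qed (simp_all add: cinner_add_left cinner_add_right scaleR_scaleC cinner_scaleC_left
      cinner_scaleC_right scaleR_conv_of_real)

lemma bounded_linear_scaleC: "bounded_linear (\<lambda>x::'a::complex_inner. a *\<^sub>C x)"
proof
  show "a *\<^sub>C (r *\<^sub>R x) = r *\<^sub>R (a *\<^sub>C x)" for r and x :: 'a
    by (simp add: scaleR_scaleC scaleC_scaleC mult.commute)
  show "\<exists>K. \<forall>x::'a. norm (a *\<^sub>C x) \<le> norm x * K"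
    by (rule exI [of _ "cmod a"]) (simp add: mult.commute)
qed (rule scaleC_add_right)

lemmas tendsto_cinner [tendsto_intros] = bounded_bilinear.tendsto [OF bounded_bilinear_cinner]
lemmas continuous_on_cinner [continuous_intros] =
  bounded_bilinear.continuous_on [OF bounded_bilinear_cinner]
lemmas tendsto_scaleC [tendsto_intros] = bounded_linear.tendsto [OF bounded_linear_scaleC]
lemmas continuous_on_scaleC [continuous_intros] =
  bounded_linear.continuous_on [OF bounded_linear_scaleC]

lemma cinner_sum_left: "cinner (sum f I) (y::'a::complex_inner) = (\<Sum>i\<in>I. cinner (f i) y)"
  by (induction I rule: infinite_finite_induct) (auto simp: cinner_add_left)

lemma cinner_sum_right: "cinner (y::'a::complex_inner) (sum f I) = (\<Sum>i\<in>I. cinner y (f i))"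
  by (induction I rule: infinite_finite_induct) (auto simp: cinner_add_right)

lemma cinner_ext_dense:
  fixes x y :: "'a::complex_inner"
  assumes "closure D = UNIV" and "\<And>v. v \<in> D \<Longrightarrow> cinner x v = cinner y v"
  shows "x = y"
proof -
  obtain f where f: "\<And>n::nat. f n \<in> D" "f \<longlonglongrightarrow> x - y"
    using assms(1) by (metis UNIV_I closure_sequential)
  have "(\<lambda>n. cinner (x - y) (f n)) \<longlonglongrightarrow> cinner (x - y) (x - y)"
    by (intro tendsto_intros f)
  moreover have "cinner (x - y) (f n) = 0" for n
    using assms(2) [OF f(1)] by (simp add: cinner_diff_left)
  ultimately have "cinner (x - y) (x - y) = 0"
    by (simp add: LIMSEQ_const_iff)
  then show ?thesis by (simp add: cinner_self)
qed

lemma cinner_ext_dense_right: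
  fixes x y :: "'a::complex_inner"
  assumes "closure D = UNIV" and "\<And>v. v \<in> D \<Longrightarrow> cinner v x = cinner v y"
  shows "x = y"
  by (rule cinner_ext_dense [OF assms(1)]) (metis assms(2) cinner_commute)

section \<open>Riesz representation, from the real inner product to the complex one\<close>

lemma complex_eqI_Re_mult:
  assumes "\<And>a. Re (a * \<alpha>) = Re (a * \<beta>)"
  shows "\<alpha> = \<beta>"
  using assms [of 1] assms [of \<i>] by (simp add: complex_eq_iff)

text \<open>The representing vector is the limit of a minimizing sequence of
  \<open>x \<mapsto> \<parallel>x\<parallel>\<^sup>2 - 2 l x\<close>; the subspace need not be closed.\<close>

lemma riesz_subspace:
  fixes l :: "'a::{real_inner, complete_space} \<Rightarrow> real"
  assumes D: "subspace D"
    and add: "\<And>x y. x \<in> D \<Longrightarrow> y \<in> D \<Longrightarrow> l (x + y) = l x + l y"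
    and scale: "\<And>r x. x \<in> D \<Longrightarrow> l (r *\<^sub>R x) = r * l x"
    and bound: "\<And>x. x \<in> D \<Longrightarrow> \<bar>l x\<bar> \<le> K * norm x"
  shows "\<exists>w\<in>closure D. \<forall>x\<in>D. inner w x = l x"
proof -
  define q where "q x = (norm x)\<^sup>2 - 2 * l x" for x
  have q_lower: "- K\<^sup>2 \<le> q x" if "x \<in> D" for x
  proof -
    have "0 \<le> (norm x - K)\<^sup>2" by simp
    then show ?thesis using bound [OF that]
      by (simp add: q_def power2_eq_square algebra_simps)
  qed
  define m where "m = Inf (q ` D)"
  have bdd: "bdd_below (q ` D)" using q_lower by (auto intro!: bdd_belowI)
  have m_le: "m \<le> q x" if "x \<in> D" for x
    unfolding m_def using bdd that by (intro cInf_lower) auto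
  have "\<exists>x\<in>D. q x < m + 1 / Suc n" for n
  proof -
    have "q ` D \<noteq> {}" using subspace_0 [OF D] by auto
    then have "\<exists>y\<in>q ` D. y < m + 1 / Suc n"
      unfolding m_def using bdd by (subst cInf_less_iff [symmetric]) auto
    then show ?thesis by auto
  qed
  then obtain x where x: "\<And>n. x n \<in> D" "\<And>n. q (x n) < m + 1 / Suc n" by metis
  \<comment> \<open>Parallelogram law: the midpoint lies in \<open>D\<close>, so \<open>q\<close> is
    at least \<open>m\<close> there, and vectors that nearly minimize \<open>q\<close> are close to
    each other.\<close>
  have par: "(norm (a - b))\<^sup>2 \<le> 2 * (q a - m) + 2 * (q b - m)" if "a \<in> D" "b \<in> D" for a b
  proof -
    have ab: "(1/2) *\<^sub>R (a + b) \<in> D" using that D by (simp add: subspace_add subspace_scale)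
    have "4 * q ((1/2) *\<^sub>R (a + b)) = (norm (a + b))\<^sup>2 - 4 * (l a + l b)"
      using that D add [of a b] scale [of "a + b" "1/2"]
      by (simp add: q_def power_divide subspace_add)
    moreover have "(norm (a - b))\<^sup>2 + (norm (a + b))\<^sup>2 = 2 * (norm a)\<^sup>2 + 2 * (norm b)\<^sup>2"
      by (simp add: power2_norm_eq_inner inner_diff inner_add inner_commute)
    ultimately show ?thesis using m_le [OF ab] by (simp add: q_def)
  qed
  have "Cauchy x"
  proof (rule metric_CauchyI)
    fix e :: real assume e: "e > 0"
    obtain N where N: "1 / Suc N < e\<^sup>2 / 4"
      using reals_Archimedean [of "e\<^sup>2 / 4"] e by (auto simp: inverse_eq_divide)
    have "dist (x i) (x j) < e" if "i \<ge> N" "j \<ge> N" for i j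
    proof -
      have "q (x k) - m < e\<^sup>2 / 4" if "k \<ge> N" for k
      proof -
        have "1 / Suc k \<le> 1 / Suc N" using that by (auto intro!: frac_le)
        then show ?thesis using x(2) [of k] N by linarith
      qed
      from this [OF that(1)] this [OF that(2)] have "(norm (x i - x j))\<^sup>2 < e\<^sup>2"
        using par [OF x(1) x(1), of i j] by argo
      then show ?thesis using e by (simp add: dist_norm power2_less_imp_less)
    qed
    then show "\<exists>N. \<forall>i\<ge>N. \<forall>j\<ge>N. dist (x i) (x j) < e" by blast
  qed
  then obtain w where w: "x \<longlonglongrightarrow> w" by (metis Cauchy_convergent convergent_def)
  have "w \<in> closure D" using x(1) w by (auto simp: closure_sequential)
  moreover have "inner w y = l y" if y: "y \<in> D" for y
  proof -
    have pos: "0 \<le> 2 * s * (inner w y - l y) + s\<^sup>2 * (norm y)\<^sup>2" for s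
    proof -
      have "- (1 / Suc n) \<le> 2 * s * (inner (x n) y - l y) + s\<^sup>2 * (norm y)\<^sup>2" for n
      proof -
        have "x n + s *\<^sub>R y \<in> D" using D x(1) y by (simp add: subspace_add subspace_scale)
        then have "m \<le> q (x n + s *\<^sub>R y)" by (rule m_le)
        also have "\<dots> = q (x n) + 2 * s * (inner (x n) y - l y) + s\<^sup>2 * (norm y)\<^sup>2"
          using D x(1) y
          by (simp add: q_def add scale subspace_scale power2_norm_eq_inner inner_add
              inner_commute power2_eq_square [of s] algebra_simps)
        finally show ?thesis using x(2) [of n] by linarith
      qed
      moreover have "(\<lambda>n. - (1 / Suc n)) \<longlonglongrightarrow> - (0::real)"
        by (intro tendsto_intros) (use LIMSEQ_inverse_real_of_nat in \<open>simp add: inverse_eq_divide\<close>)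
      moreover have "(\<lambda>n. 2 * s * (inner (x n) y - l y) + s\<^sup>2 * (norm y)\<^sup>2)
          \<longlonglongrightarrow> 2 * s * (inner w y - l y) + s\<^sup>2 * (norm y)\<^sup>2"
        by (intro tendsto_intros w)
      ultimately have "- 0 \<le> 2 * s * (inner w y - l y) + s\<^sup>2 * (norm y)\<^sup>2"
        by (intro LIMSEQ_le) auto
      then show ?thesis by simp
    qed
    define \<delta> where "\<delta> = inner w y - l y"
    \<comment> \<open>A step of \<open>- \<delta> / N\<close> in direction \<open>y\<close> would
      lower the quadratic unless \<open>\<delta> = 0\<close>; the added \<open>1\<close> keeps the
      division meaningful for \<open>y = 0\<close>.\<close>
    define N where "N = (norm y)\<^sup>2 + 1"
    have "0 \<le> 2 * (- \<delta> / N) * \<delta> + (- \<delta> / N)\<^sup>2 * (norm y)\<^sup>2"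
      using pos [of "- \<delta> / N"] by (simp add: \<delta>_def)
    also have "\<dots> \<le> 2 * (- \<delta> / N) * \<delta> + (- \<delta> / N)\<^sup>2 * N"
      by (intro add_left_mono mult_left_mono) (auto simp: N_def)
    also have "\<dots> = - (\<delta>\<^sup>2 / N)"
      by (simp add: power2_eq_square field_simps N_def add_nonneg_eq_0_iff)
    finally have "\<delta>\<^sup>2 / N \<le> 0" by simp
    moreover have "N > 0" by (simp add: N_def add_nonneg_pos)
    ultimately have "\<delta> = 0" by (simp add: divide_le_0_iff)
    then show ?thesis by (simp add: \<delta>_def)
  qed
  ultimately show ?thesis by blast
qed

lemma closed_subspace_eq_UNIV:
  fixes V :: "'a::{real_inner, complete_space} set"
  assumes "subspace V" "closed V" and "\<And>y. (\<And>x. x \<in> V \<Longrightarrow> inner y x = 0) \<Longrightarrow> y = 0"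
  shows "V = UNIV"
proof -
  have "y \<in> V" for y
  proof -
    \<comment> \<open>\<open>w\<close> is the orthogonal projection of \<open>y\<close> onto
      \<open>V\<close>.\<close>
    obtain w where w: "w \<in> closure V" "\<And>x. x \<in> V \<Longrightarrow> inner w x = inner y x"
      using riesz_subspace [OF assms(1), of "inner y" "norm y"]
      by (auto simp: inner_add Cauchy_Schwarz_ineq2)
    have "y - w = 0" using w by (intro assms(3)) (simp add: inner_diff)
    then show ?thesis using w assms(2) by simp
  qed
  then show ?thesis by auto
qed

text \<open>Multiplying the argument by complex scalars recovers \<open>l\<close> from its real
  part. The norm bound rests on \<open>w\<close> lying in the closure of \<open>D\<close>: applying
  \<open>bound\<close> along vectors of \<open>D\<close> that tend to \<open>w\<close> gives
  \<open>(norm w)^2 \<le> K * norm w\<close>.\<close>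

lemma riesz_antilinear:
  fixes l :: "'a::complex_hilbert \<Rightarrow> complex"
  assumes D: "0 \<in> D" "\<And>x y. x \<in> D \<Longrightarrow> y \<in> D \<Longrightarrow> x + y \<in> D" "\<And>a x. x \<in> D \<Longrightarrow> a *\<^sub>C x \<in> D"
    and add: "\<And>x y. x \<in> D \<Longrightarrow> y \<in> D \<Longrightarrow> l (x + y) = l x + l y"
    and scale: "\<And>a x. x \<in> D \<Longrightarrow> l (a *\<^sub>C x) = cnj a * l x"
    and bound: "\<And>x. x \<in> D \<Longrightarrow> cmod (l x) \<le> K * norm x"
    and K: "K \<ge> 0"
  shows "\<exists>w. (\<forall>x\<in>D. l x = cinner x w) \<and> norm w \<le> K"
proof -
  have "subspace D" using D by (simp add: subspace_def scaleR_scaleC)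
  then obtain w where w: "w \<in> closure D" "\<And>x. x \<in> D \<Longrightarrow> inner w x = Re (l x)"
    using riesz_subspace [of D "\<lambda>x. Re (l x)" K] add scale bound
      order_trans [OF abs_Re_le_cmod bound]
    by (auto simp: scaleR_scaleC)
  have eq: "l x = cinner x w" if x: "x \<in> D" for x
  proof (rule complex_eqI_Re_mult)
    fix a
    have "Re (a * l x) = Re (l (cnj a *\<^sub>C x))" using x by (simp add: scale)
    also have "\<dots> = Re (cinner (cnj a *\<^sub>C x) w)"
      using w(2) [OF D(3) [OF x], of "cnj a"] by (metis inner_commute inner_eq_Re_cinner)
    finally show "Re (a * l x) = Re (a * cinner x w)" by (simp add: cinner_scaleC_left)
  qed
  obtain f where f: "\<And>n::nat. f n \<in> D" "f \<longlonglongrightarrow> w"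
    using w(1) by (auto simp: closure_sequential)
  have "cmod (cinner w w) \<le> K * norm w"
  proof (rule LIMSEQ_le)
    show "(\<lambda>n. cmod (cinner (f n) w)) \<longlonglongrightarrow> cmod (cinner w w)"
      by (intro tendsto_intros f)
    show "(\<lambda>n. K * norm (f n)) \<longlonglongrightarrow> K * norm w"
      by (intro tendsto_intros f)
    show "\<exists>N. \<forall>n\<ge>N. cmod (cinner (f n) w) \<le> K * norm (f n)"
      using bound [OF f(1)] eq [OF f(1)] by auto
  qed
  then have "norm w \<le> K"
    using K by (cases "w = 0") (auto simp: cinner_self power2_eq_square norm_mult)
  with eq show ?thesis by blast
qed

section \<open>Powers of contractions and limits controlled on dense sets\<close>

lemma bounded_opI:
  assumes "\<And>x y. S (x + y) = S x + S y" "\<And>a x. S (a *\<^sub>C x) = a *\<^sub>C S (x::'a::complex_inner)"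
    and "\<And>x. norm (S x) \<le> K * norm x"
  shows "bounded_op S"
  unfolding bounded_op_def
proof (intro conjI allI)
  show "bounded_linear S"
    using assms(1,3) by (intro bounded_linear_intro [of S K])
      (auto simp: scaleR_scaleC assms(2) mult.commute)
qed (rule assms(2))

lemma bounded_op_bounded_linear: "bounded_op S \<Longrightarrow> bounded_linear S"
  by (simp add: bounded_op_def)

lemma bounded_op_scaleC: "bounded_op S \<Longrightarrow> S (a *\<^sub>C x) = a *\<^sub>C S x"
  by (simp add: bounded_op_def)

lemma bounded_op_add: "bounded_op S \<Longrightarrow> S (x + y) = S x + S y"
  by (simp add: bounded_op_def bounded_linear_def linear_add)

lemma bounded_op_diff: "bounded_op S \<Longrightarrow> S (x - y) = S x - S y"
  by (simp add: bounded_op_def bounded_linear_def linear_diff)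

lemma bounded_op_zero: "bounded_op S \<Longrightarrow> S 0 = 0"
  by (simp add: bounded_op_def bounded_linear_def linear_0)

lemmas bounded_op_tendsto = bounded_linear.tendsto [OF bounded_op_bounded_linear]

lemma tendsto_dense_contraction:
  fixes P :: "'b \<Rightarrow> 'a::real_normed_vector \<Rightarrow> 'a"
  assumes "\<And>h x y. P h (x - y) = P h x - P h y" "\<And>h x. norm (P h x) \<le> norm x"
    and "closure E = UNIV" "\<And>x. x \<in> E \<Longrightarrow> ((\<lambda>h. P h x) \<longlongrightarrow> x) F"
  shows "((\<lambda>h. P h x) \<longlongrightarrow> x) F"
proof (rule tendstoI)
  fix e :: real assume e: "e > 0"
  then obtain y where y: "y \<in> E" "dist y x < e / 3"
    using assms(3) closure_approachable [of x E] by (metis UNIV_I divide_pos_pos zero_less_numeral)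
  from assms(4) [OF y(1)] e have "\<forall>\<^sub>F h in F. dist (P h y) y < e / 3"
    by (intro tendstoD) simp_all
  then show "\<forall>\<^sub>F h in F. dist (P h x) x < e"
  proof eventually_elim
    case (elim h)
    have "dist (P h x) (P h y) \<le> dist x y"
      using assms(1) [of h x y] assms(2) [of h "x - y"] by (simp add: dist_norm)
    then show ?case
      using elim y(2) dist_triangle [of "P h x" x "P h y"] dist_triangle [of "P h y" x y]
      by (simp add: dist_commute)
  qed
qed

lemma funpow_contraction:
  fixes Q :: "'a::real_normed_vector \<Rightarrow> 'a"
  assumes "\<And>x. norm (Q x) \<le> norm x"
  shows "norm ((Q ^^ n) x) \<le> norm x"
  by (induction n) (auto intro: order_trans [OF assms])

lemma bounded_op_funpow:
  assumes Q: "bounded_op Q" "\<And>x. norm (Q x) \<le> norm x"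
  shows "bounded_op (Q ^^ n)"
proof (rule bounded_opI [of _ 1])
  show "(Q ^^ n) (x + y) = (Q ^^ n) x + (Q ^^ n) y" for x y
    by (induction n) (simp_all add: bounded_op_add [OF Q(1)])
  show "(Q ^^ n) (a *\<^sub>C x) = a *\<^sub>C (Q ^^ n) x" for a x
    by (induction n) (simp_all add: bounded_op_scaleC [OF Q(1)])
qed (use funpow_contraction [of Q] Q(2) in simp)

lemma funpow_commute_apply:
  assumes "\<And>x. P (Q x) = Q (P x)"
  shows "P ((Q ^^ n) x) = (Q ^^ n) (P x)"
  by (induction n) (simp_all add: assms)

text \<open>Telescoping: for commuting contractions each of the \<open>n\<close> steps contributes
  at most the error of a single step. One-step errors of order \<open>1 / n^2\<close> thus add up to
  order \<open>1 / n\<close>, which is how the approximants of the group are compared.\<close>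

lemma norm_funpow_diff_le:
  fixes P Q :: "'a::complex_inner \<Rightarrow> 'a"
  assumes P: "bounded_op P" "\<And>x. norm (P x) \<le> norm x"
    and Q: "bounded_op Q" "\<And>x. norm (Q x) \<le> norm x"
    and comm: "\<And>x. P (Q x) = Q (P x)"
  shows "norm ((P ^^ n) x - (Q ^^ n) x) \<le> real n * norm (P x - Q x)"
proof (induction n)
  case (Suc n)
  have "(P ^^ Suc n) x - (Q ^^ Suc n) x
      = P ((P ^^ n) x - (Q ^^ n) x) + (Q ^^ n) (P x - Q x)"
    using funpow_commute_apply [of P Q n x, OF comm]
    by (simp add: bounded_op_diff [OF P(1)] bounded_op_diff [OF bounded_op_funpow [OF Q]]
        funpow_swap1)
  then have "norm ((P ^^ Suc n) x - (Q ^^ Suc n) x)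
      \<le> norm ((P ^^ n) x - (Q ^^ n) x) + norm (P x - Q x)"
    using norm_triangle_ineq [of "P ((P ^^ n) x - (Q ^^ n) x)" "(Q ^^ n) (P x - Q x)"]
      P(2) [of "(P ^^ n) x - (Q ^^ n) x"] funpow_contraction [of Q n "P x - Q x"] Q(2)
    by simp
  then show ?case using Suc by (simp add: algebra_simps)
qed simp

lemma bounded_op_eq_dense:
  assumes "bounded_op S" "bounded_op T" and E: "closure E = UNIV" and "\<And>x. x \<in> E \<Longrightarrow> S x = T x"
  shows "S x = T x"
proof -
  obtain f where f: "\<And>n::nat. f n \<in> E" "f \<longlonglongrightarrow> x"
    using E by (metis UNIV_I closure_sequential)
  have "(\<lambda>n. S (f n)) \<longlonglongrightarrow> S x" "(\<lambda>n. T (f n)) \<longlonglongrightarrow> T x"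
    using bounded_op_tendsto assms(1,2) f(2) by blast+
  then show ?thesis using assms(4) f(1) LIMSEQ_unique by simp
qed

lemma has_vector_derivative_at_0I:
  assumes "((\<lambda>t. (1 / t) *\<^sub>R (f t - f 0)) \<longlongrightarrow> f') (at 0)"
  shows "(f has_vector_derivative f') (at 0)"
  unfolding has_vector_derivative_def has_derivative_iff_norm
proof
  show "bounded_linear (\<lambda>t. t *\<^sub>R f')" by (rule bounded_linear_scaleR_left)
  have "((\<lambda>t. norm ((1 / t) *\<^sub>R (f t - f 0) - f')) \<longlongrightarrow> 0) (at 0)"
    using assms by (intro tendsto_norm_zero LIM_zero)
  then show "((\<lambda>t. norm (f t - f 0 - (t - 0) *\<^sub>R f') / norm (t - 0)) \<longlongrightarrow> 0) (at 0)"
  proof (rule Lim_transform_eventually)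
    have "norm ((1 / t) *\<^sub>R (f t - f 0) - f') = norm (f t - f 0 - t *\<^sub>R f') / norm t" if "t \<noteq> 0" for t
    proof -
      have "(1 / t) *\<^sub>R (f t - f 0) - f' = (1 / t) *\<^sub>R (f t - f 0 - t *\<^sub>R f')"
        using that by (simp add: scaleR_diff_right)
      then show ?thesis by simp
    qed
    then show "\<forall>\<^sub>F t in at 0. norm ((1 / t) *\<^sub>R (f t - f 0) - f')
        = norm (f t - f 0 - (t - 0) *\<^sub>R f') / norm (t - 0)"
      by (auto simp: eventually_at_filter)
  qed
qed

lemma convergent_dense_contraction:
  fixes P :: "nat \<Rightarrow> 'a::complex_hilbert \<Rightarrow> 'a"
  assumes P: "\<And>k. bounded_op (P k)" "\<And>k x. norm (P k x) \<le> norm x"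
    and E: "closure E = UNIV" "\<And>x. x \<in> E \<Longrightarrow> convergent (\<lambda>k. P k x)"
  shows "convergent (\<lambda>k. P k x)"
proof (rule Cauchy_convergent, rule metric_CauchyI)
  fix e :: real assume e: "e > 0"
  then obtain y where y: "y \<in> E" "dist y x < e / 3"
    using E(1) closure_approachable [of x E] by (metis UNIV_I divide_pos_pos zero_less_numeral)
  obtain M where M: "\<And>m n. m \<ge> M \<Longrightarrow> n \<ge> M \<Longrightarrow> dist (P m y) (P n y) < e / 3"
    using metric_CauchyD [OF convergent_Cauchy [OF E(2) [OF y(1)]], of "e / 3"] e by auto
  have le: "dist (P k x) (P k y) < e / 3" for k
    using P(2) [of k "x - y"] y(2)
    by (simp add: dist_norm norm_minus_commute bounded_op_diff [OF P(1)])
  have "dist (P m x) (P n x) < e" if "m \<ge> M" "n \<ge> M" for m n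
    using M [OF that] le [of m] le [of n] dist_triangle [of "P m x" "P n x" "P m y"]
      dist_triangle [of "P m y" "P n x" "P n y"]
    by (simp add: dist_commute)
  then show "\<exists>M. \<forall>m\<ge>M. \<forall>n\<ge>M. dist (P m x) (P n x) < e" by blast
qed

text \<open>Serves for limits in which operator and argument vary together; the contraction bound
  absorbs the change of argument uniformly in \<open>n\<close>.\<close>

lemma tendsto_contraction_family:
  fixes P :: "'b \<Rightarrow> 'a::real_normed_vector \<Rightarrow> 'a"
  assumes "\<And>n x y. P n (x - y) = P n x - P n y" "\<And>n x. norm (P n x) \<le> norm x"
    and "(x \<longlongrightarrow> a) F" "((\<lambda>n. P n a) \<longlongrightarrow> b) F"
  shows "((\<lambda>n. P n (x n)) \<longlongrightarrow> b) F"
proof -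
  have "((\<lambda>n. P n (x n - a)) \<longlongrightarrow> 0) F"
  proof (rule Lim_null_comparison [OF always_eventually])
    show "\<forall>n. norm (P n (x n - a)) \<le> norm (x n - a)" using assms(2) by blast
    show "((\<lambda>n. norm (x n - a)) \<longlongrightarrow> 0) F"
      using assms(3) by (intro tendsto_norm_zero LIM_zero)
  qed
  from tendsto_add [OF this assms(4)] show ?thesis by (simp add: assms(1))
qed

section \<open>Resolvents of a self-adjoint operator\<close>

locale self_adjoint_operator =
  fixes H :: "'a::complex_hilbert unbounded_op"
  assumes self_adjoint: "self_adjoint H"
begin

abbreviation "\<D> \<equiv> dom_op H"

lemma dom_dense: "closure \<D> = UNIV"
  using self_adjoint by (simp add: self_adjoint_def)

lemma dom_zero: "0 \<in> \<D>"
  and dom_add: "u \<in> \<D> \<Longrightarrow> v \<in> \<D> \<Longrightarrow> u + v \<in> \<D>"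
  and dom_scaleC: "u \<in> \<D> \<Longrightarrow> a *\<^sub>C u \<in> \<D>"
  and app_add: "u \<in> \<D> \<Longrightarrow> v \<in> \<D> \<Longrightarrow> app H (u + v) = app H u + app H v"
  and app_scaleC: "u \<in> \<D> \<Longrightarrow> app H (a *\<^sub>C u) = a *\<^sub>C app H u"
  using self_adjoint by (auto simp: self_adjoint_def linear_op_def)

lemma dom_diff: "u \<in> \<D> \<Longrightarrow> v \<in> \<D> \<Longrightarrow> u - v \<in> \<D>"
  and app_diff: "u \<in> \<D> \<Longrightarrow> v \<in> \<D> \<Longrightarrow> app H (u - v) = app H u - app H v"
  using dom_add [of u "(-1) *\<^sub>C v"] app_add [of u "(-1) *\<^sub>C v"] dom_scaleC [of v "-1"]
    app_scaleC [of v "-1"]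
  by simp_all

lemma symmetric: "u \<in> \<D> \<Longrightarrow> v \<in> \<D> \<Longrightarrow> cinner (app H u) v = cinner u (app H v)"
proof -
  assume "u \<in> \<D>" "v \<in> \<D>"
  then have "(v, app H v) \<in> adjoint_graph H"
    using self_adjoint by (auto simp: self_adjoint_def op_graph_def)
  then show ?thesis using \<open>u \<in> \<D>\<close> by (simp add: adjoint_graph_def)
qed

lemma adjoint_domain:
  assumes "\<And>u. u \<in> \<D> \<Longrightarrow> cinner (app H u) v = cinner u w"
  shows "v \<in> \<D>" and "app H v = w"
proof -
  have "(v, w) \<in> adjoint_graph H" using assms by (simp add: adjoint_graph_def)
  then show "v \<in> \<D>" and "app H v = w"
    using self_adjoint by (auto simp: self_adjoint_def op_graph_def)
qed

text \<open>Adjoints are closed: their defining identity, tested on a fixed \<open>u\<close>, passes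
  to the limit.\<close>

lemma closed_op:
  assumes "\<forall>\<^sub>F n in F. x n \<in> \<D>" "(x \<longlongrightarrow> v) F" "((\<lambda>n. app H (x n)) \<longlongrightarrow> w) F" "F \<noteq> bot"
  shows "v \<in> \<D>" and "app H v = w"
proof -
  have "cinner (app H u) v = cinner u w" if u: "u \<in> \<D>" for u
  proof (rule tendsto_unique [OF assms(4)])
    show "((\<lambda>n. cinner (app H u) (x n)) \<longlongrightarrow> cinner (app H u) v) F"
      by (intro tendsto_intros assms)
    have "((\<lambda>n. cinner u (app H (x n))) \<longlongrightarrow> cinner u w) F"
      by (intro tendsto_intros assms)
    then show "((\<lambda>n. cinner (app H u) (x n)) \<longlongrightarrow> cinner u w) F"
      by (rule Lim_transform_eventually) (use assms(1) in eventually_elim, simp add: u symmetric)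
  qed
  then show "v \<in> \<D>" and "app H v = w" using adjoint_domain by blast+
qed

section \<open>Inverting \<open>1 - \<i>hH\<close> for real \<open>h\<close>\<close>

lemma cinner_app_self: "x \<in> \<D> \<Longrightarrow> Im (cinner x (app H x)) = 0"
  using symmetric [of x x] cinner_commute [of x "app H x"]
  by (metis Reals_cnj_iff complex_is_Real_iff)

text \<open>Pythagoras: \<open>\<langle>x, Hx\<rangle>\<close> is real, so \<open>x\<close> and
  \<open>\<i>hHx\<close> are orthogonal for the real inner product. Injectivity, closed range and
  the contraction bound of the inverse all come from here.\<close>

lemma norm_shift:
  assumes x: "x \<in> \<D>"
  shows "(norm (x - (\<i> * complex_of_real h) *\<^sub>C app H x))\<^sup>2 = (norm x)\<^sup>2 + h\<^sup>2 * (norm (app H x))\<^sup>2"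
proof -
  have "inner x ((\<i> * complex_of_real h) *\<^sub>C app H x) = 0"
    using cinner_app_self [OF x] by (simp add: inner_eq_Re_cinner cinner_scaleC_right)
  then have "(norm (x - (\<i> * complex_of_real h) *\<^sub>C app H x))\<^sup>2
      = (norm x)\<^sup>2 + (norm ((\<i> * complex_of_real h) *\<^sub>C app H x))\<^sup>2"
    by (simp only: power2_norm_eq_inner inner_diff_left inner_diff_right) (simp add: inner_commute)
  then show ?thesis by (simp add: norm_mult power_mult_distrib)
qed

lemma norm_shift_ge: "x \<in> \<D> \<Longrightarrow> norm x \<le> norm (x - (\<i> * complex_of_real h) *\<^sub>C app H x)"
  by (rule power2_le_imp_le) (simp_all add: norm_shift)

text \<open>The range is closed by \<open>norm_shift_ge\<close> and closedness of \<open>H\<close>.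
  A nonzero vector orthogonal to it would be an eigenvector of \<open>H\<close> with the imaginary
  eigenvalue \<open>\<i>/h\<close>, which symmetry excludes.\<close>

lemma shift_surj:
  assumes h: "h \<noteq> 0"
  shows "\<exists>x\<in>\<D>. x - (\<i> * complex_of_real h) *\<^sub>C app H x = y"
proof -
  let ?L = "\<lambda>x. x - (\<i> * complex_of_real h) *\<^sub>C app H x"
  have L_diff: "?L (a - b) = ?L a - ?L b" if "a \<in> \<D>" "b \<in> \<D>" for a b
    using that by (simp add: app_diff scaleC_diff_right)
  have L_scaleC: "?L (a *\<^sub>C x) = a *\<^sub>C ?L x" if "x \<in> \<D>" for a x
    using that by (simp add: app_scaleC scaleC_diff_right scaleC_scaleC mult.commute [of a])
  have "?L ` \<D> = UNIV"
  proof (rule closed_subspace_eq_UNIV)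
    have "?L 0 = 0" using L_scaleC [OF dom_zero, of 0] by simp
    moreover have "?L x + ?L y \<in> ?L ` \<D>" if "x \<in> \<D>" "y \<in> \<D>" for x y
      using that
      by (intro image_eqI [of _ _ "x + y"]) (auto simp: app_add scaleC_add_right dom_add)
    moreover have "r *\<^sub>R ?L x \<in> ?L ` \<D>" if "x \<in> \<D>" for r x
      using that L_scaleC [OF that, of "of_real r"]
      by (intro image_eqI [of _ _ "r *\<^sub>R x"]) (simp_all only: scaleR_scaleC dom_scaleC)
    ultimately show "subspace (?L ` \<D>)"
      unfolding subspace_def using dom_zero by (auto intro: image_eqI [of _ _ 0])
  next
    show "closed (?L ` \<D>)"
      unfolding closed_sequential_limits
    proof (intro allI impI, elim conjE)
      fix f y assume f: "\<forall>n. f n \<in> ?L ` \<D>" and lim: "f \<longlonglongrightarrow> y"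
      then have "\<forall>n. \<exists>x\<in>\<D>. f n = ?L x" by blast
      then obtain x where x: "\<And>n. x n \<in> \<D>" "\<And>n. f n = ?L (x n)" by metis
      have le: "dist (x m) (x n) \<le> dist (f m) (f n)" for m n
        unfolding dist_norm x(2) L_diff [OF x(1) x(1), symmetric]
        by (intro norm_shift_ge dom_diff x(1))
      have "Cauchy x"
      proof (rule metric_CauchyI)
        fix e :: real assume "e > 0"
        then obtain M where "\<And>m n. m \<ge> M \<Longrightarrow> n \<ge> M \<Longrightarrow> dist (f m) (f n) < e"
          using metric_CauchyD [OF LIMSEQ_imp_Cauchy [OF lim]] by metis
        then show "\<exists>M. \<forall>m\<ge>M. \<forall>n\<ge>M. dist (x m) (x n) < e"
          using le le_less_trans by blast
      qed
      then obtain v where v: "x \<longlonglongrightarrow> v" by (metis Cauchy_convergent convergent_def)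
      have eq: "app H (x n) = (1 / (\<i> * complex_of_real h)) *\<^sub>C (x n - f n)" for n
        using h by (simp add: x(2) scaleC_scaleC)
      have lim': "(\<lambda>n. app H (x n)) \<longlonglongrightarrow> (1 / (\<i> * complex_of_real h)) *\<^sub>C (v - y)"
        unfolding eq by (intro tendsto_intros v lim)
      note closed_op [OF _ v lim']
      then have "v \<in> \<D>" "app H v = (1 / (\<i> * complex_of_real h)) *\<^sub>C (v - y)"
        using x(1) by simp_all
      then have "?L v = y" using h by (simp add: scaleC_scaleC)
      then show "y \<in> ?L ` \<D>" using \<open>v \<in> \<D>\<close> by blast
    qed
  next
    fix y assume y: "\<And>x. x \<in> ?L ` \<D> \<Longrightarrow> inner y x = 0"
    have ortho: "cinner (?L x) y = 0" if x: "x \<in> \<D>" for x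
    proof -
      have "Re (a * cinner y (?L x)) = 0" for a
        using y [OF imageI, OF dom_scaleC [OF x, of a]]
        unfolding L_scaleC [OF x] inner_eq_Re_cinner cinner_scaleC_right .
      then have "cinner y (?L x) = 0" by (intro complex_eqI_Re_mult) simp
      then show ?thesis by (metis cinner_commute complex_cnj_zero)
    qed
    have 1: "cinner (app H x) y = cinner x ((\<i> / complex_of_real h) *\<^sub>C y)" if "x \<in> \<D>" for x
    proof -
      have "cinner x y = - (\<i> * complex_of_real h * cinner (app H x) y)"
        using ortho [OF that] by (simp add: cinner_diff_left cinner_scaleC_left eq_neg_iff_add_eq_0)
      then show ?thesis using h by (simp add: cinner_scaleC_right)
    qed
    have "y \<in> \<D>" "app H y = (\<i> / complex_of_real h) *\<^sub>C y"
      using adjoint_domain [OF 1] by auto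
    with cinner_app_self [OF this(1)] h have "(norm y)\<^sup>2 / h = 0"
      by (simp add: cinner_scaleC_right cinner_self Im_divide_of_real)
    then show "y = 0" using h by simp
  qed
  then have "y \<in> ?L ` \<D>" by simp
  then show ?thesis by (rule imageE) auto
qed

text \<open>The resolvent \<open>(1 - \<i>hH)\<^sup>-\<^sup>1\<close>; at \<open>h = 0\<close> it is set to the identity on the whole space,
  although \<open>1 - \<i>hH\<close> is only defined on the domain.\<close>

definition res :: "real \<Rightarrow> 'a \<Rightarrow> 'a" where
  "res h y = (if h = 0 then y
     else THE x. x \<in> \<D> \<and> x - (\<i> * complex_of_real h) *\<^sub>C app H x = y)"

lemma res_0 [simp]: "res 0 y = y"
  by (simp add: res_def)

lemma shift_inj:
  assumes "x \<in> \<D>" "y \<in> \<D>"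
    "x - (\<i> * complex_of_real h) *\<^sub>C app H x = y - (\<i> * complex_of_real h) *\<^sub>C app H y"
  shows "x = y"
proof -
  have "(x - y) - (\<i> * complex_of_real h) *\<^sub>C app H (x - y)
      = (x - (\<i> * complex_of_real h) *\<^sub>C app H x) - (y - (\<i> * complex_of_real h) *\<^sub>C app H y)"
    using assms(1,2) by (simp add: app_diff scaleC_diff_right)
  then show ?thesis
    using norm_shift_ge [OF dom_diff [OF assms(1,2)], of h] by (simp only: assms(3)) simp
qed

lemma res_shift: "x \<in> \<D> \<Longrightarrow> res h (x - (\<i> * complex_of_real h) *\<^sub>C app H x) = x"
  by (cases "h = 0") (simp, simp only: res_def if_False, rule the_equality, blast, metis shift_inj)

lemma res_dom: "h \<noteq> 0 \<Longrightarrow> res h y \<in> \<D>"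
  using shift_surj [of h y] res_shift by metis

lemma res_dom': "y \<in> \<D> \<Longrightarrow> res h y \<in> \<D>"
  using res_dom [of h y] by (cases "h = 0") simp_all

lemma shift_res: "res h y - (\<i> * complex_of_real h) *\<^sub>C app H (res h y) = y"
proof (cases "h = 0")
  case False
  then obtain x where x: "x \<in> \<D>" "x - (\<i> * complex_of_real h) *\<^sub>C app H x = y"
    using shift_surj by blast
  then have "res h y = x" using res_shift by blast
  with x show ?thesis by simp
qed simp

lemma app_res_eq: "(\<i> * complex_of_real h) *\<^sub>C app H (res h y) = res h y - y"
proof -
  have "res h y - (res h y - (\<i> * complex_of_real h) *\<^sub>C app H (res h y)) = res h y - y"
    by (simp only: shift_res)
  then show ?thesis by simp
qed

lemma res_eqI: "x \<in> \<D> \<Longrightarrow> x - (\<i> * complex_of_real h) *\<^sub>C app H x = y \<Longrightarrow> res h y = x"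
  using res_shift by blast

lemma norm_res_le: "norm (res h y) \<le> norm y"
proof (cases "h = 0")
  case False
  from norm_shift_ge [OF res_dom [OF this, of y], of h] show ?thesis
    by (simp only: shift_res)
qed simp

lemma bounded_op_res: "bounded_op (res h)"
proof (cases "h = 0")
  case True
  then show ?thesis by (intro bounded_opI [of _ 1]) simp_all
next
  case h: False
  show ?thesis
  proof (rule bounded_opI [of _ 1])
    show "res h (x + y) = res h x + res h y" for x y
    proof (rule res_eqI)
      show "res h x + res h y - (\<i> * complex_of_real h) *\<^sub>C app H (res h x + res h y) = x + y"
        using h by (simp add: app_add res_dom scaleC_add_right app_res_eq)
    qed (simp add: dom_add res_dom h)
    show "res h (a *\<^sub>C x) = a *\<^sub>C res h x" for a x
    proof (rule res_eqI)
      have "(\<i> * complex_of_real h) *\<^sub>C app H (a *\<^sub>C res h x)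
          = a *\<^sub>C (\<i> * complex_of_real h) *\<^sub>C app H (res h x)"
        using h by (simp add: app_scaleC res_dom scaleC_scaleC mult_ac)
      then show "a *\<^sub>C res h x - (\<i> * complex_of_real h) *\<^sub>C app H (a *\<^sub>C res h x) = a *\<^sub>C x"
        using h by (simp add: app_res_eq scaleC_diff_right)
    qed (simp add: dom_scaleC res_dom h)
  qed (use norm_res_le in auto)
qed

lemmas res_add = bounded_op_add [OF bounded_op_res]
  and res_diff = bounded_op_diff [OF bounded_op_res]
  and res_scaleC = bounded_op_scaleC [OF bounded_op_res]
  and res_tendsto = bounded_op_tendsto [OF bounded_op_res]

lemma app_res:
  assumes x: "x \<in> \<D>" shows "app H (res h x) = res h (app H x)"
proof (cases "h = 0")
  case h: False
  have "x \<in> \<D>" "res h x \<in> \<D>" by (simp_all add: x res_dom h)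
  moreover note app_res_eq [of h x]
  \<comment> \<open>\<open>app H (res h x)\<close> is a multiple of \<open>res h x - x\<close>,
    hence again in the domain; this permits a second application of \<open>H\<close>.\<close>
  ultimately have dom: "(\<i> * complex_of_real h) *\<^sub>C app H (res h x) \<in> \<D>"
    by (simp add: dom_diff)
  then have "(1 / (\<i> * complex_of_real h)) *\<^sub>C (\<i> * complex_of_real h) *\<^sub>C app H (res h x) \<in> \<D>"
    by (rule dom_scaleC)
  then have "app H (res h x) \<in> \<D>" using h by (simp add: scaleC_scaleC)
  moreover have "app H (res h x) - (\<i> * complex_of_real h) *\<^sub>C app H (app H (res h x)) = app H x"
  proof -
    have "app H (res h x) - (\<i> * complex_of_real h) *\<^sub>C app H (app H (res h x))
        = app H (res h x - (\<i> * complex_of_real h) *\<^sub>C app H (res h x))"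
      using \<open>app H (res h x) \<in> \<D>\<close> \<open>res h x \<in> \<D>\<close> by (simp add: app_diff app_scaleC dom_scaleC)
    then show ?thesis by (simp only: shift_res)
  qed
  ultimately show ?thesis using res_eqI [of "app H (res h x)" h "app H x"] by simp
qed auto

lemma res_minus_id: "x \<in> \<D> \<Longrightarrow> res h x - x = (\<i> * complex_of_real h) *\<^sub>C res h (app H x)"
  by (cases "h = 0") (simp_all add: app_res_eq flip: app_res)

lemma norm_res_minus_id: "x \<in> \<D> \<Longrightarrow> norm (res h x - x) \<le> \<bar>h\<bar> * norm (app H x)"
  unfolding res_minus_id norm_scaleC by (auto simp: norm_mult intro!: mult_left_mono norm_res_le)

lemma cinner_res: "cinner (res h x) y = cinner x (res (- h) y)"
proof (cases "h = 0")
  case h: False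
  let ?u = "res h x" and ?v = "res (- h) y"
  have d: "?u \<in> \<D>" "?v \<in> \<D>" by (simp_all add: h res_dom)
  have "cinner (?u - (\<i> * complex_of_real h) *\<^sub>C app H ?u) ?v
      = cinner ?u (?v - (\<i> * complex_of_real (- h)) *\<^sub>C app H ?v)"
    using symmetric [OF d]
    by (simp add: cinner_add_right cinner_diff_left cinner_scaleC_left cinner_scaleC_right)
  then show ?thesis by (simp only: shift_res)
qed auto

lemma res_commute: "res a (res b x) = res b (res a x)"
proof (cases "a = 0 \<or> b = 0")
  case False
  then have ab: "a \<noteq> 0" "b \<noteq> 0" by auto
  let ?y = "res b (res a x)"
  have "?y - (\<i> * complex_of_real a) *\<^sub>C app H ?y
      = res b (res a x - (\<i> * complex_of_real a) *\<^sub>C app H (res a x))"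
    using ab by (simp add: app_res res_dom res_diff res_scaleC)
  also have "\<dots> = res b x" using ab by (simp add: shift_res)
  finally show ?thesis using ab by (intro res_eqI) (auto simp: res_dom)
qed auto

lemma res_tendsto_id: "((\<lambda>h. res h y) \<longlongrightarrow> y) (at 0)"
proof (rule tendsto_dense_contraction [OF _ _ dom_dense])
  show "((\<lambda>h. res h x) \<longlongrightarrow> x) (at 0)" if "x \<in> \<D>" for x
  proof (rule Lim_null_comparison [THEN LIM_zero_cancel])
    show "\<forall>\<^sub>F h in at 0. norm (res h x - x) \<le> \<bar>h\<bar> * norm (app H x)"
      using norm_res_minus_id [OF that] by simp
    show "((\<lambda>h. \<bar>h\<bar> * norm (app H x)) \<longlongrightarrow> 0) (at (0::real))"
      by (intro tendsto_eq_intros) auto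
  qed
qed (simp_all add: res_diff norm_res_le)

end

section \<open>Stone's theorem\<close>

context self_adjoint_operator
begin

text \<open>The domain of \<open>H^2\<close>, where the local errors of the approximation are
  quadratic in the step size.\<close>

definition dom2 :: "'a set" where
  "dom2 = {x \<in> \<D>. app H x \<in> \<D>}"

text \<open>Two applications of \<open>res h\<close> land in \<open>dom2\<close>, and they tend
  strongly to the identity because \<open>res h\<close> is a contraction.\<close>

lemma dom2_dense: "closure dom2 = UNIV"
proof -
  have "y \<in> closure dom2" for y
  proof -
    define h where "h n = inverse (real (Suc n))" for n
    have h: "h n \<noteq> 0" for n by (simp add: h_def)
    have "filterlim h (at 0) sequentially"
      unfolding filterlim_at using LIMSEQ_inverse_real_of_nat h by (auto simp: h_def [abs_def])
    then have lim: "(\<lambda>n. res (h n) y) \<longlonglongrightarrow> y"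
      using filterlim_compose [OF res_tendsto_id] by blast
    have "(\<lambda>n. res (h n) (res (h n) y) - y) \<longlonglongrightarrow> 0"
    proof (rule Lim_null_comparison)
      show "\<forall>\<^sub>F n in sequentially. norm (res (h n) (res (h n) y) - y) \<le> 2 * norm (res (h n) y - y)"
      proof (rule always_eventually, rule allI)
        fix n
        have "res (h n) (res (h n) y) - y = res (h n) (res (h n) y - y) + (res (h n) y - y)"
          by (simp add: res_diff)
        then have "norm (res (h n) (res (h n) y) - y)
            \<le> norm (res (h n) (res (h n) y - y)) + norm (res (h n) y - y)"
          by (simp only: norm_triangle_ineq)
        then show "norm (res (h n) (res (h n) y) - y) \<le> 2 * norm (res (h n) y - y)"
          using norm_res_le [of "h n" "res (h n) y - y"] by linarith
      qed
      show "(\<lambda>n. 2 * norm (res (h n) y - y)) \<longlonglongrightarrow> 0"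
        using lim by (intro tendsto_mult_right_zero tendsto_norm_zero) (simp add: LIM_zero)
    qed
    then have "(\<lambda>n. res (h n) (res (h n) y)) \<longlonglongrightarrow> y" by (rule LIM_zero_cancel)
    moreover have "res (h n) (res (h n) y) \<in> dom2" for n
      by (simp add: dom2_def res_dom h app_res)
    ultimately show ?thesis unfolding closure_sequential
      by (intro exI [of _ "\<lambda>n. res (h n) (res (h n) y)"]) simp
  qed
  then show ?thesis by auto
qed

lemma res_dom2: "x \<in> dom2 \<Longrightarrow> res h x \<in> dom2"
  by (simp add: dom2_def res_dom' app_res)

lemma res_in_dom2: "x \<in> \<D> \<Longrightarrow> h \<noteq> 0 \<Longrightarrow> res h x \<in> dom2"
  by (simp add: dom2_def res_dom app_res)

text \<open>The source is \<open>(1 - \<i>aH)(1 - \<i>bH) = (1 - \<i>(a + b)H) - ab H\<^sup>2\<close>.\<close>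

lemma norm_res_add_le:
  assumes x: "x \<in> dom2"
  shows "norm (res (a + b) x - res a (res b x)) \<le> \<bar>a * b\<bar> * norm (app H (app H x))"
proof -
  define w where "w = res (a + b) x"
  have w: "w \<in> \<D>" "app H w \<in> \<D>"
    using res_dom2 [OF x] by (auto simp: w_def dom2_def)
  define v where "v = w - (\<i> * complex_of_real b) *\<^sub>C app H w"
  have v: "v \<in> \<D>" by (simp add: v_def w dom_diff dom_scaleC)
  have "v - (\<i> * complex_of_real a) *\<^sub>C app H v
      = w - (\<i> * complex_of_real (a + b)) *\<^sub>C app H w
        - complex_of_real (a * b) *\<^sub>C app H (app H w)"
    by (simp add: v_def w app_diff app_scaleC dom_scaleC scaleC_diff_right scaleC_scaleC
        distrib_left scaleC_add_left mult_ac)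
  also have "\<dots> = x - complex_of_real (a * b) *\<^sub>C app H (app H w)"
    by (simp only: w_def shift_res)
  finally have "res a (x - complex_of_real (a * b) *\<^sub>C app H (app H w)) = v"
    using v by (intro res_eqI)
  then have "res b (res a (x - complex_of_real (a * b) *\<^sub>C app H (app H w))) = w"
    using w by (simp add: v_def res_shift)
  then have eq: "w - res a (res b x) = - (complex_of_real (a * b) *\<^sub>C res b (res a (app H (app H w))))"
    by (simp only: res_diff res_scaleC res_commute [of b a]) (simp add: algebra_simps)
  have "norm (res b (res a (app H (app H w)))) \<le> norm (app H (app H x))"
    using norm_res_le order_trans x
    by (metis (no_types, lifting) app_res dom2_def mem_Collect_eq w_def)
  then show ?thesis
    using arg_cong [OF eq, of norm] by (simp add: w_def norm_mult abs_mult mult_left_mono)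
qed

text \<open>The implicit Euler scheme for \<open>x' = \<i>Hx\<close> with \<open>2^k\<close> equal
  steps. Passing from \<open>k\<close> to \<open>k + 1\<close> halves every step, so one local
  estimate compares successive approximants.\<close>

definition approx :: "nat \<Rightarrow> real \<Rightarrow> 'a \<Rightarrow> 'a" where
  "approx k t = (res (t / 2 ^ k) ^^ (2 ^ k))"

lemma bounded_op_approx: "bounded_op (approx k t)"
  unfolding approx_def by (intro bounded_op_funpow bounded_op_res norm_res_le)

lemma norm_approx_le: "norm (approx k t x) \<le> norm x"
  unfolding approx_def by (intro funpow_contraction norm_res_le)

text \<open>A step of length \<open>2s\<close> against two of length \<open>s\<close>: the local
  error is \<open>s^2\<close> times the norm of \<open>H^2 x\<close>, and there are
  \<open>2^k\<close> such steps with \<open>s = t / 2^(k+1)\<close>.\<close>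

lemma norm_approx_step:
  assumes x: "x \<in> dom2"
  shows "norm (approx (Suc k) t x - approx k t x) \<le> (t\<^sup>2 / 4 * norm (app H (app H x))) / 2 ^ k"
proof -
  define s where "s = t / 2 ^ Suc k"
  have s: "t / 2 ^ k = s + s" by (simp add: s_def)
  have eq: "approx (Suc k) t = (res s \<circ> res s) ^^ (2 ^ k)"
  proof -
    have "(res s ^^ 2) ^^ (2 ^ k) = res s ^^ (2 * 2 ^ k)" by (rule funpow_mult)
    then show ?thesis by (simp add: approx_def s_def numeral_2_eq_2 del: funpow_mult)
  qed
  have "norm (approx k t x - approx (Suc k) t x)
      \<le> real (2 ^ k) * norm (res (s + s) x - (res s \<circ> res s) x)"
    unfolding eq unfolding approx_def s
  proof (rule norm_funpow_diff_le)
    show "bounded_op (res s \<circ> res s)"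
      using bounded_op_funpow [OF bounded_op_res norm_res_le, of 2 s] by (simp add: numeral_2_eq_2)
    show "norm ((res s \<circ> res s) x) \<le> norm x" for x
      using norm_res_le order_trans by (metis comp_apply)
    show "res (s + s) ((res s \<circ> res s) x) = (res s \<circ> res s) (res (s + s) x)" for x
      by (simp add: res_commute [of "2 * s"])
  qed (auto intro: bounded_op_res norm_res_le)
  also have "\<dots> \<le> real (2 ^ k) * (\<bar>s * s\<bar> * norm (app H (app H x)))"
    using norm_res_add_le [OF x, of s s] by (intro mult_left_mono) auto
  also have "\<dots> = (t\<^sup>2 / 4 * norm (app H (app H x))) / 2 ^ k"
    by (simp add: s_def abs_mult power2_eq_square field_simps)
  finally show ?thesis by (simp add: norm_minus_commute)
qed

lemma norm_approx_diff_le: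
  assumes x: "x \<in> dom2"
  shows "norm (approx (k + m) t x - approx k t x) \<le> (t\<^sup>2 / 2 * norm (app H (app H x))) / 2 ^ k"
proof -
  define c where "c = t\<^sup>2 / 4 * norm (app H (app H x))"
  have c: "c \<ge> 0" by (simp add: c_def)
  \<comment> \<open>\<open>2 - 2 / 2^m\<close> is the sum of the first \<open>m\<close> terms of the
    geometric series \<open>1 + 1/2 + 1/4 + ...\<close>, which collects the errors of the single
    refinements.\<close>
  have "norm (approx (k + m) t x - approx k t x) \<le> c / 2 ^ k * (2 - 2 / 2 ^ m)"
  proof (induction m)
    case (Suc m)
    have "norm (approx (k + Suc m) t x - approx k t x)
        \<le> norm (approx (Suc (k + m)) t x - approx (k + m) t x)
          + norm (approx (k + m) t x - approx k t x)"
      using norm_triangle_ineq [of "approx (Suc (k + m)) t x - approx (k + m) t x"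
          "approx (k + m) t x - approx k t x"] by simp
    also have "\<dots> \<le> c / 2 ^ (k + m) + c / 2 ^ k * (2 - 2 / 2 ^ m)"
      using norm_approx_step [OF x, of "k + m" t] Suc by (simp add: c_def)
    also have "\<dots> = c / 2 ^ k * (2 - 2 / 2 ^ Suc m)"
      by (simp add: field_simps power_add)
    finally show ?case .
  qed simp
  also have "\<dots> \<le> c / 2 ^ k * 2"
    using c by (intro mult_left_mono) auto
  finally show ?thesis by (simp add: c_def)
qed

lemma convergent_approx: "convergent (\<lambda>k. approx k t x)"
proof (rule convergent_dense_contraction [OF bounded_op_approx norm_approx_le dom2_dense])
  fix x assume x: "x \<in> dom2"
  define c where "c = t\<^sup>2 / 2 * norm (app H (app H x))"
  show "convergent (\<lambda>k. approx k t x)"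
  proof (rule Cauchy_convergent, rule metric_CauchyI)
    fix e :: real assume "e > 0"
    have "(\<lambda>k. c / 2 ^ k) \<longlonglongrightarrow> 0"
      using LIMSEQ_divide_realpow_zero [of 2 c] by simp
    then obtain M where M: "c / 2 ^ M < e / 2"
      using order_tendstoD(2) [of _ 0 sequentially "e / 2"] \<open>e > 0\<close>
      by (force simp: eventually_sequentially)
    have le: "dist (approx k t x) (approx M t x) < e / 2" if "k \<ge> M" for k
      using norm_approx_diff_le [OF x, of M "k - M" t] M that by (simp add: dist_norm c_def)
    have "dist (approx m t x) (approx n t x) < e" if "m \<ge> M" "n \<ge> M" for m n
      using le [OF that(1)] le [OF that(2)]
        dist_triangle [of "approx m t x" "approx n t x" "approx M t x"]
      by (simp add: dist_commute)
    then show "\<exists>M. \<forall>m\<ge>M. \<forall>n\<ge>M. dist (approx m t x) (approx n t x) < e" by blast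
  qed
qed

definition grp :: "real \<Rightarrow> 'a \<Rightarrow> 'a" where
  "grp t x = lim (\<lambda>k. approx k t x)"

lemma approx_lim: "(\<lambda>k. approx k t x) \<longlonglongrightarrow> grp t x"
  using convergent_approx by (simp add: grp_def convergent_LIMSEQ_iff)

lemma norm_grp_le: "norm (grp t x) \<le> norm x"
  by (rule LIMSEQ_le_const2 [OF tendsto_norm [OF approx_lim]]) (auto intro: norm_approx_le)

lemma bounded_op_grp: "bounded_op (grp t)"
proof (rule bounded_opI [of _ 1])
  show "grp t (x + y) = grp t x + grp t y" for x y
    by (rule LIMSEQ_unique [OF approx_lim])
      (simp only: bounded_op_add [OF bounded_op_approx], intro tendsto_add approx_lim)
  show "grp t (a *\<^sub>C x) = a *\<^sub>C grp t x" for a x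
    by (rule LIMSEQ_unique [OF approx_lim])
      (simp only: bounded_op_scaleC [OF bounded_op_approx], intro tendsto_scaleC approx_lim)
qed (simp add: norm_grp_le)

lemmas grp_add = bounded_op_add [OF bounded_op_grp]
  and grp_diff = bounded_op_diff [OF bounded_op_grp]
  and grp_scaleC = bounded_op_scaleC [OF bounded_op_grp]
  and grp_tendsto = bounded_op_tendsto [OF bounded_op_grp]

lemma grp_0 [simp]: "grp 0 x = x"
proof -
  have "(res 0 ^^ n) x = x" for n by (induction n) auto
  then have "approx k 0 x = x" for k by (simp add: approx_def)
  then show ?thesis using approx_lim [of 0 x] by (simp add: LIMSEQ_const_iff)
qed

text \<open>On \<open>dom2\<close> one step of length \<open>(s + t) / 2^k\<close> differs from
  steps of lengths \<open>s / 2^k\<close> and \<open>t / 2^k\<close> by an error of order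
  \<open>4^-k\<close>; the \<open>2^k\<close> steps accumulate only \<open>2^-k\<close>. Density
  does the rest.\<close>

lemma grp_plus: "grp (s + t) x = grp s (grp t x)"
proof -
  have op: "bounded_op (\<lambda>x. grp s (grp t x))"
  proof (rule bounded_opI [of _ 1])
    show "norm (grp s (grp t x)) \<le> 1 * norm x" for x
      using norm_grp_le [of s "grp t x"] norm_grp_le [of t x] by simp
  qed (simp_all add: grp_add grp_scaleC)
  show ?thesis
  proof (rule bounded_op_eq_dense [OF bounded_op_grp op dom2_dense])
    fix x assume x: "x \<in> dom2"
    have "(\<lambda>k. approx k (s + t) x - approx k s (approx k t x)) \<longlonglongrightarrow> 0"
    proof (rule Lim_null_comparison [OF always_eventually])
      show "\<forall>k. norm (approx k (s + t) x - approx k s (approx k t x))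
          \<le> (\<bar>s * t\<bar> * norm (app H (app H x))) / 2 ^ k"
      proof
        fix k
        let ?a = "s / 2 ^ k" and ?b = "t / 2 ^ k"
        have pow: "((res ?a \<circ> res ?b) ^^ n) x = (res ?a ^^ n) ((res ?b ^^ n) x)" for n x
          by (induction n) (simp_all add: funpow_commute_apply [of "res ?b" "res ?a"] res_commute)
        have "norm ((res (?a + ?b) ^^ (2 ^ k)) x - ((res ?a \<circ> res ?b) ^^ (2 ^ k)) x)
            \<le> real (2 ^ k) * norm (res (?a + ?b) x - (res ?a \<circ> res ?b) x)"
        proof (rule norm_funpow_diff_le)
          show *: "norm ((res ?a \<circ> res ?b) x) \<le> norm x" for x
            using norm_res_le order_trans by (metis comp_apply)
          show "bounded_op (res ?a \<circ> res ?b)"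
            by (rule bounded_opI [of _ 1]) (use * in \<open>simp_all add: res_add res_scaleC\<close>)
          show "res (?a + ?b) ((res ?a \<circ> res ?b) x) = (res ?a \<circ> res ?b) (res (?a + ?b) x)" for x
            by (simp add: res_commute [of "?a + ?b"])
        qed (auto intro: bounded_op_res norm_res_le)
        also have "\<dots> \<le> real (2 ^ k) * (\<bar>?a * ?b\<bar> * norm (app H (app H x)))"
          using norm_res_add_le [OF x, of ?a ?b] by (intro mult_left_mono) auto
        also have "\<dots> = (\<bar>s * t\<bar> * norm (app H (app H x))) / 2 ^ k"
          by (simp add: abs_mult)
        finally show "norm (approx k (s + t) x - approx k s (approx k t x))
          \<le> (\<bar>s * t\<bar> * norm (app H (app H x))) / 2 ^ k"
          by (simp add: approx_def pow add_divide_distrib)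
      qed
      show "(\<lambda>k. (\<bar>s * t\<bar> * norm (app H (app H x))) / 2 ^ k) \<longlonglongrightarrow> 0"
        by (rule LIMSEQ_divide_realpow_zero) simp
    qed
    from tendsto_diff [OF approx_lim this, of "s + t" x]
    have 1: "(\<lambda>k. approx k s (approx k t x)) \<longlonglongrightarrow> grp (s + t) x" by simp
    have "(\<lambda>k. approx k s (approx k t x - grp t x)) \<longlonglongrightarrow> 0"
    proof (rule Lim_null_comparison [OF always_eventually])
      show "\<forall>k. norm (approx k s (approx k t x - grp t x)) \<le> norm (approx k t x - grp t x)"
        by (simp add: norm_approx_le)
      show "(\<lambda>k. norm (approx k t x - grp t x)) \<longlonglongrightarrow> 0"
        using approx_lim by (intro tendsto_norm_zero LIM_zero)
    qed
    from tendsto_add [OF this approx_lim, of s "grp t x"]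
    have "(\<lambda>k. approx k s (approx k t x)) \<longlonglongrightarrow> grp s (grp t x)"
      by (simp add: bounded_op_diff [OF bounded_op_approx])
    with 1 show "grp (s + t) x = grp s (grp t x)" by (rule LIMSEQ_unique)
  qed
qed

lemma cinner_approx: "cinner (approx k t x) y = cinner x (approx k (- t) y)"
proof -
  have "cinner ((res h ^^ n) x) y = cinner x ((res (- h) ^^ n) y)" for h n x
    by (induction n arbitrary: x) (simp_all add: cinner_res funpow_swap1)
  then show ?thesis by (simp add: approx_def)
qed

lemma cinner_grp: "cinner (grp t x) y = cinner x (grp (- t) y)"
proof (rule LIMSEQ_unique)
  show "(\<lambda>k. cinner (approx k t x) y) \<longlonglongrightarrow> cinner (grp t x) y"
    by (intro tendsto_intros approx_lim)
  show "(\<lambda>k. cinner (approx k t x) y) \<longlonglongrightarrow> cinner x (grp (- t) y)"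
    unfolding cinner_approx by (intro tendsto_intros approx_lim)
qed

lemma cinner_grp_grp: "cinner (grp t x) (grp t y) = cinner x y"
  using grp_plus [of "- t" t y] by (simp add: cinner_grp)

section \<open>Behaviour at time zero and the generator\<close>

lemma norm_approx_minus_id:
  assumes x: "x \<in> \<D>" shows "norm (approx k t x - x) \<le> \<bar>t\<bar> * norm (app H x)"
proof -
  \<comment> \<open>The identity is written as a power so that the telescoping bound applies to
    it.\<close>
  have "norm ((res (t / 2 ^ k) ^^ (2 ^ k)) x - ((\<lambda>x. x) ^^ (2 ^ k)) x)
      \<le> real (2 ^ k) * norm (res (t / 2 ^ k) x - x)"
    by (rule norm_funpow_diff_le) (auto intro: bounded_op_res norm_res_le bounded_opI [of _ 1])
  also have "\<dots> \<le> real (2 ^ k) * (\<bar>t / 2 ^ k\<bar> * norm (app H x))"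
    by (intro mult_left_mono norm_res_minus_id x) simp
  finally show ?thesis by (simp add: approx_def id_def [symmetric])
qed

lemma norm_grp_minus_id: "x \<in> \<D> \<Longrightarrow> norm (grp t x - x) \<le> \<bar>t\<bar> * norm (app H x)"
  by (rule LIMSEQ_le_const2 [OF tendsto_norm [OF tendsto_diff [OF approx_lim tendsto_const]]])
    (auto intro: norm_approx_minus_id)

lemma grp_tendsto_id: "((\<lambda>t. grp t x) \<longlongrightarrow> x) (at 0)"
proof (rule tendsto_dense_contraction [OF _ _ dom_dense])
  show "((\<lambda>t. grp t x) \<longlongrightarrow> x) (at 0)" if "x \<in> \<D>" for x
  proof (rule Lim_null_comparison [THEN LIM_zero_cancel])
    show "\<forall>\<^sub>F t in at 0. norm (grp t x - x) \<le> \<bar>t\<bar> * norm (app H x)"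
      using norm_grp_minus_id [OF that] by simp
    show "((\<lambda>t. \<bar>t\<bar> * norm (app H x)) \<longlongrightarrow> 0) (at (0::real))"
      by (intro tendsto_eq_intros) auto
  qed
qed (simp_all add: grp_diff norm_grp_le)

lemma continuous_on_grp: "continuous_on S (\<lambda>t. grp t x)"
proof -
  have "isCont (\<lambda>t. grp t x) t" for t
  proof -
    have "((\<lambda>s. grp t (grp s x)) \<longlongrightarrow> grp t x) (at 0)"
      by (intro grp_tendsto grp_tendsto_id)
    then have "((\<lambda>s. grp (t + s) x) \<longlongrightarrow> grp t x) (at 0)"
      by (simp add: grp_plus)
    then show ?thesis by (simp add: isCont_iff)
  qed
  then show ?thesis by (simp add: continuous_at_imp_continuous_on)
qed

lemma unitary_group_grp: "unitary_group grp"
proof -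
  have "surj (grp t)" for t
    by (rule surjI [of _ "grp (- t)"]) (simp flip: grp_plus)
  then show ?thesis
    unfolding unitary_group_def unitary_def
    by (auto simp: bounded_op_grp cinner_grp_grp grp_plus continuous_on_grp fun_eq_iff)
qed

text \<open>\<open>approx 0 t\<close> is the single Euler step \<open>res t\<close>. Its distance to
  the group costs \<open>t^2 / 2\<close> and its own Taylor remainder \<open>t^2\<close>; the sum is
  rounded up to \<open>2 t^2\<close>.\<close>

lemma norm_grp_taylor:
  assumes x: "x \<in> dom2"
  shows "norm (grp t x - x - (\<i> * complex_of_real t) *\<^sub>C app H x)
    \<le> 2 * t\<^sup>2 * norm (app H (app H x))"
proof -
  have "norm (grp t x - approx 0 t x) \<le> t\<^sup>2 / 2 * norm (app H (app H x))"
    by (rule LIMSEQ_le_const2 [OF tendsto_norm [OF tendsto_diff [OF approx_lim tendsto_const]]])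
      (use norm_approx_diff_le [OF x, of 0] in auto)
  moreover have "norm (approx 0 t x - x - (\<i> * complex_of_real t) *\<^sub>C app H x)
      \<le> t\<^sup>2 * norm (app H (app H x))"
  proof -
    have "approx 0 t x - x - (\<i> * complex_of_real t) *\<^sub>C app H x
        = (\<i> * complex_of_real t) *\<^sub>C (res t (app H x) - app H x)"
      using x res_minus_id [of x t] by (simp add: approx_def dom2_def scaleC_diff_right)
    moreover have "\<bar>t\<bar> * norm (res t (app H x) - app H x) \<le> \<bar>t\<bar> * (\<bar>t\<bar> * norm (app H (app H x)))"
      using x by (intro mult_left_mono norm_res_minus_id) (auto simp: dom2_def)
    ultimately show ?thesis by (simp add: norm_mult power2_eq_square)
  qed
  moreover have "grp t x - x - (\<i> * complex_of_real t) *\<^sub>C app H x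
      = (grp t x - approx 0 t x) + (approx 0 t x - x - (\<i> * complex_of_real t) *\<^sub>C app H x)"
    by simp
  ultimately have "norm (grp t x - x - (\<i> * complex_of_real t) *\<^sub>C app H x)
      \<le> t\<^sup>2 / 2 * norm (app H (app H x)) + t\<^sup>2 * norm (app H (app H x))"
    by (metis add_mono norm_triangle_le)
  also have "\<dots> \<le> 2 * t\<^sup>2 * norm (app H (app H x))"
    by (simp add: algebra_simps)
  finally show ?thesis .
qed

text \<open>The Taylor bound requires \<open>dom2\<close>, so \<open>x\<close> is replaced by
  \<open>y = res h x\<close>, close to \<open>x\<close> in graph norm. The difference quotients of
  \<open>x - y\<close> are bounded by the norm of \<open>H (x - y)\<close> uniformly in
  \<open>t\<close>, which leaves three errors of \<open>e / 3\<close>.\<close>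

lemma has_vector_derivative_grp_0:
  assumes x: "x \<in> \<D>"
  shows "((\<lambda>t. grp t x) has_vector_derivative \<i> *\<^sub>C app H x) (at 0)"
proof -
  have "((\<lambda>t. (1 / t) *\<^sub>R (grp t x - x)) \<longlongrightarrow> \<i> *\<^sub>C app H x) (at 0)"
  proof (rule tendstoI)
    fix e :: real assume e: "e > 0"
    have "((\<lambda>h. app H (res h x)) \<longlongrightarrow> app H x) (at 0)"
      using res_tendsto_id [of "app H x"] x by (simp add: app_res)
    then have "\<forall>\<^sub>F h in at 0. dist (app H (res h x)) (app H x) < e / 3"
      using e by (intro tendstoD) simp_all
    moreover have "\<forall>\<^sub>F h in at (0::real). h \<noteq> 0"
      by (simp add: eventually_at_filter)
    ultimately have "\<forall>\<^sub>F h in at 0. dist (app H (res h x)) (app H x) < e / 3 \<and> h \<noteq> 0"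
      by (rule eventually_conj)
    then obtain h where h: "dist (app H (res h x)) (app H x) < e / 3" "h \<noteq> 0"
      using eventually_happens [of _ "at (0::real)"] by force
    define y where "y = res h x"
    have y: "y \<in> dom2" "y \<in> \<D>" using res_in_dom2 [OF x h(2)] by (auto simp: y_def dom2_def)
    define M where "M = norm (app H (app H y))"
    have "((\<lambda>t. 2 * \<bar>t\<bar> * M) \<longlongrightarrow> 0) (at (0::real))"
      by (intro tendsto_eq_intros) auto
    then have "\<forall>\<^sub>F t in at 0. 2 * \<bar>t\<bar> * M < e / 3"
      using e by (intro order_tendstoD(2)) auto
    with \<open>\<forall>\<^sub>F h in at (0::real). h \<noteq> 0\<close>
    show "\<forall>\<^sub>F t in at 0. dist ((1 / t) *\<^sub>R (grp t x - x)) (\<i> *\<^sub>C app H x) < e"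
    proof eventually_elim
      case (elim t)
      let ?d = "grp t y - y - (\<i> * complex_of_real t) *\<^sub>C app H y"
      have t: "(1 / t) *\<^sub>R (\<i> * complex_of_real t) *\<^sub>C app H y = \<i> *\<^sub>C app H y"
        using elim(1) by (simp add: scaleR_scaleC scaleC_scaleC)
      have "(1 / t) *\<^sub>R (grp t x - x) - \<i> *\<^sub>C app H x
          = (1 / t) *\<^sub>R (grp t (x - y) - (x - y)) + (1 / t) *\<^sub>R ?d + \<i> *\<^sub>C (app H y - app H x)"
        using t by (simp add: grp_diff scaleR_diff_right scaleC_diff_right)
      moreover have "norm ((1 / t) *\<^sub>R (grp t (x - y) - (x - y))) \<le> norm (app H (x - y))"
        using norm_grp_minus_id [OF dom_diff [OF x y(2)], of t] elim(1)
        by (simp add: divide_le_eq mult.commute)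
      moreover have "norm (app H (x - y)) < e / 3"
        using h(1) x y by (simp add: app_diff y_def dist_norm norm_minus_commute)
      moreover have "norm ((1 / t) *\<^sub>R ?d) \<le> 2 * \<bar>t\<bar> * M"
      proof -
        have "norm ((1 / t) *\<^sub>R ?d) \<le> \<bar>1 / t\<bar> * (2 * t\<^sup>2 * M)"
          using norm_grp_taylor [OF y(1), of t] by (simp add: M_def divide_right_mono)
        also have "\<dots> = 2 * \<bar>t\<bar> * M"
          using elim(1) by (simp add: power2_eq_square abs_if)
        finally show ?thesis .
      qed
      moreover have "norm (\<i> *\<^sub>C (app H y - app H x)) < e / 3"
        using h(1) by (simp add: y_def dist_norm)
      ultimately show ?case
        using elim(2)
          norm_triangle_ineq [of "(1 / t) *\<^sub>R (grp t (x - y) - (x - y)) + (1 / t) *\<^sub>R ?d"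
            "\<i> *\<^sub>C (app H y - app H x)"]
          norm_triangle_ineq [of "(1 / t) *\<^sub>R (grp t (x - y) - (x - y))" "(1 / t) *\<^sub>R ?d"]
        by (simp add: dist_norm)
    qed
  qed
  then show ?thesis by (intro has_vector_derivative_at_0I) simp
qed

text \<open>That the generator is no larger than \<open>\<i>H\<close> is self-adjointness:
  differentiating the constant function \<open>cinner (grp t v) (grp t u)\<close> with
  \<open>v\<close> in the domain of \<open>H\<close> puts \<open>u\<close> in the domain of the
  adjoint.\<close>

lemma grp_generator:
  "{(u, w). ((\<lambda>t. grp t u) has_vector_derivative \<i> *\<^sub>C w) (at 0)} = op_graph H"
proof (intro equalityI subsetI; clarify)
  fix u w assume deriv: "((\<lambda>t. grp t u) has_vector_derivative \<i> *\<^sub>C w) (at 0)"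
  have "cinner (app H v) u = cinner v w" if v: "v \<in> \<D>" for v
  proof -
    have "((\<lambda>t. cinner (grp t v) (grp t u)) has_vector_derivative
        cinner (grp 0 v) (\<i> *\<^sub>C w) + cinner (\<i> *\<^sub>C app H v) (grp 0 u)) (at 0)"
      by (rule bounded_bilinear.has_vector_derivative [OF bounded_bilinear_cinner
            has_vector_derivative_grp_0 [OF v] deriv])
    moreover have "((\<lambda>t. cinner (grp t v) (grp t u)) has_vector_derivative 0) (at 0)"
      by (simp add: cinner_grp_grp)
    ultimately have "cinner v (\<i> *\<^sub>C w) + cinner (\<i> *\<^sub>C app H v) u = 0"
      using vector_derivative_unique_at by fastforce
    then show ?thesis by (simp add: cinner_scaleC_left cinner_scaleC_right)
  qed
  from adjoint_domain [OF this] show "(u, w) \<in> op_graph H" by (auto simp: op_graph_def)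
qed (auto simp: op_graph_def has_vector_derivative_grp_0)

section \<open>Uniqueness in Stone's theorem\<close>

lemma unitary_group_deriv:
  assumes U: "unitary_group U"
    and gen: "{(u, w). ((\<lambda>t. U t u) has_vector_derivative \<i> *\<^sub>C w) (at 0)} = op_graph H"
    and x: "x \<in> \<D>"
  shows "U s x \<in> \<D>" and "app H (U s x) = U s (app H x)"
    and "((\<lambda>t. U t x) has_vector_derivative \<i> *\<^sub>C U s (app H x)) (at s)"
proof -
  have op: "bounded_op (U s)" and plus: "U (a + b) y = U a (U b y)" for a b y
    using U by (auto simp: unitary_group_def unitary_def)
  have "(x, app H x) \<in> op_graph H" using x by (auto simp: op_graph_def)
  then have d0: "((\<lambda>t. U t x) has_vector_derivative \<i> *\<^sub>C app H x) (at 0)"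
    using gen by auto
  have d1: "((\<lambda>t. U s (U t x)) has_vector_derivative \<i> *\<^sub>C U s (app H x)) (at 0)"
    using bounded_linear.has_vector_derivative [OF bounded_op_bounded_linear [OF op] d0]
    by (simp add: bounded_op_scaleC [OF op])
  moreover have "U s (U t x) = U t (U s x)" for t
    by (metis plus add.commute)
  ultimately have "(U s x, U s (app H x)) \<in> op_graph H" unfolding gen [symmetric] by simp
  then show "U s x \<in> \<D>" and "app H (U s x) = U s (app H x)"
    by (auto simp: op_graph_def)
  have "((\<lambda>t::real. t - s) has_vector_derivative 1) (at s)"
    by (auto intro!: derivative_eq_intros)
  from vector_diff_chain_at [OF this, of "\<lambda>t. U s (U t x)"] d1
  have "((\<lambda>t. U s (U (t - s) x)) has_vector_derivative \<i> *\<^sub>C U s (app H x)) (at s)"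
    by (simp add: o_def)
  then show "((\<lambda>t. U t x) has_vector_derivative \<i> *\<^sub>C U s (app H x)) (at s)"
    by (simp flip: plus)
qed

text \<open>By symmetry of \<open>H\<close>, \<open>cinner (U t x) (V t y)\<close> has derivative
  zero and keeps its value at time zero; expanding the squared norm of \<open>U t y - V t y\<close>
  then gives zero.\<close>

lemma unitary_group_unique:
  assumes U: "unitary_group U"
    and U_gen: "{(u, w). ((\<lambda>t. U t u) has_vector_derivative \<i> *\<^sub>C w) (at 0)} = op_graph H"
    and V: "unitary_group V"
    and V_gen: "{(u, w). ((\<lambda>t. V t u) has_vector_derivative \<i> *\<^sub>C w) (at 0)} = op_graph H"
  shows "U = V"
proof (intro ext)
  fix t y
  have op: "bounded_op (U t)" "bounded_op (V t)" for t
    using U V by (auto simp: unitary_group_def unitary_def)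
  have inv: "cinner (U t a) (U t b) = cinner a b" "cinner (V t a) (V t b) = cinner a b" for t a b
    using U V by (auto simp: unitary_group_def unitary_def)
  have const: "cinner (U t x) (V t y) = cinner x y" if x: "x \<in> \<D>" and y: "y \<in> \<D>" for x y
  proof -
    have "((\<lambda>t. cinner (U t x) (V t y)) has_vector_derivative 0) (at s within UNIV)" for s
    proof -
      have "((\<lambda>t. cinner (U t x) (V t y)) has_vector_derivative
          cinner (U s x) (\<i> *\<^sub>C V s (app H y)) + cinner (\<i> *\<^sub>C U s (app H x)) (V s y)) (at s)"
        by (rule bounded_bilinear.has_vector_derivative [OF bounded_bilinear_cinner
              unitary_group_deriv(3) [OF U U_gen x] unitary_group_deriv(3) [OF V V_gen y]])
      moreover have "cinner (U s (app H x)) (V s y) = cinner (U s x) (V s (app H y))"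
        using symmetric [OF unitary_group_deriv(1) [OF U U_gen x]
            unitary_group_deriv(1) [OF V V_gen y], of s s]
        by (simp add: unitary_group_deriv(2) [OF U U_gen x] unitary_group_deriv(2) [OF V V_gen y])
      ultimately show ?thesis by (simp add: cinner_scaleC_left cinner_scaleC_right)
    qed
    then obtain c where "\<And>s. cinner (U s x) (V s y) = c"
      using has_vector_derivative_zero_constant [OF convex_UNIV] by (metis UNIV_I)
    from this [of t] this [of 0] show ?thesis
      using U V by (simp add: unitary_group_def)
  qed
  show "U t y = V t y"
  proof (rule bounded_op_eq_dense [OF op dom_dense])
    fix y assume y: "y \<in> \<D>"
    have "norm (U t y - V t y) = 0"
    proof -
      have "cinner (V t y) (U t y) = cinner y y"
        using const [OF y y] by (metis cinner_commute)
      then have "cinner (U t y - V t y) (U t y - V t y) = 0"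
        using const [OF y y] by (simp add: cinner_diff_left cinner_diff_right inv)
      then show ?thesis by (simp add: cinner_self)
    qed
    then show "U t y = V t y" by simp
  qed
qed

lemma exp_i_eq_grp: "exp_i H = grp"
  unfolding exp_i_def
  using unitary_group_grp grp_generator unitary_group_unique by (intro the_equality) auto

lemma has_vector_derivative_grp:
  "x \<in> \<D> \<Longrightarrow> ((\<lambda>t. grp t x) has_vector_derivative \<i> *\<^sub>C grp s (app H x)) (at s)"
  by (rule unitary_group_deriv(3) [OF unitary_group_grp grp_generator])

end

section \<open>Square integrability of correlations\<close>

text \<open>Gram-Schmidt, in a form that admits linearly dependent families. It provides coordinates
  in which a Gram matrix consists of finite sums.\<close>

lemma finite_orthonormal_frame:
  fixes Z :: "'a::complex_inner set"
  assumes "finite Z"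
  shows "\<exists>B. finite B \<and> (\<forall>a\<in>B. \<forall>b\<in>B. cinner a b = of_bool (a = b))
    \<and> (\<forall>z\<in>Z. z = (\<Sum>b\<in>B. cinner b z *\<^sub>C b))"
  using assms
proof induction
  case empty
  show ?case by (rule exI [of _ "{}"]) simp
next
  case (insert z Z)
  then obtain B where B: "finite B" "\<And>a b. a \<in> B \<Longrightarrow> b \<in> B \<Longrightarrow> cinner a b = of_bool (a = b)"
    and Z: "\<And>z. z \<in> Z \<Longrightarrow> z = (\<Sum>b\<in>B. cinner b z *\<^sub>C b)" by metis
  define r where "r = z - (\<Sum>b\<in>B. cinner b z *\<^sub>C b)"
  have orth: "cinner b r = 0" if "b \<in> B" for b
  proof -
    have "cinner b (\<Sum>b\<in>B. cinner b z *\<^sub>C b) = (\<Sum>a\<in>B. cinner a z * of_bool (b = a))"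
      unfolding cinner_sum_right cinner_scaleC_right
      by (intro sum.cong refl) (simp add: B(2) that)
    also have "\<dots> = cinner b z" using B(1) that
      by (simp add: of_bool_def if_distrib [of "\<lambda>c. _ * c"] cong: if_cong)
    finally show ?thesis by (simp add: r_def cinner_diff_right)
  qed
  show ?case
  proof (cases "r = 0")
    case True
    then have "z = (\<Sum>b\<in>B. cinner b z *\<^sub>C b)" by (simp add: r_def)
    then show ?thesis using B Z by (intro exI [of _ B]) blast
  next
    case False
    define e where "e = complex_of_real (1 / norm r) *\<^sub>C r"
    have e: "cinner e e = 1"
      using False by (simp add: cinner_self e_def norm_divide)
    have be: "cinner b e = 0" "cinner e b = 0" if "b \<in> B" for b
      using orth [OF that] cinner_commute [of r b]
      by (simp_all add: e_def cinner_scaleC_right cinner_scaleC_left)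
    have notin: "e \<notin> B" using be e by fastforce
    have "cinner e (\<Sum>b\<in>B. cinner b y *\<^sub>C b) = 0" for y
      by (simp add: cinner_sum_right cinner_scaleC_right be)
    then have eZ: "cinner e y = 0" if "y \<in> Z" for y
      using Z [OF that] by metis
    have "cinner e z = cinner e r"
      using \<open>\<And>y. cinner e (\<Sum>b\<in>B. cinner b y *\<^sub>C b) = 0\<close> by (simp add: r_def cinner_diff_right)
    also have "\<dots> = complex_of_real (norm r)"
      using False by (simp add: e_def cinner_scaleC_left cinner_self power2_eq_square)
    finally have "cinner e z *\<^sub>C e = r"
      using False by (simp add: e_def scaleC_scaleC)
    then have z: "z = (\<Sum>b\<in>insert e B. cinner b z *\<^sub>C b)"
      using B(1) notin by (simp add: r_def)
    show ?thesis
    proof (intro exI [of _ "insert e B"] conjI ballI)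
      show "finite (insert e B)" using B(1) by simp
      show "cinner a b = of_bool (a = b)" if "a \<in> insert e B" "b \<in> insert e B" for a b
        using that e be notin by (auto simp: B(2))
      show "y = (\<Sum>b\<in>insert e B. cinner b y *\<^sub>C b)" if "y \<in> insert z Z" for y
      proof (cases "y = z")
        case False
        then show ?thesis using that Z [of y] B(1) notin eZ [of y] by simp
      qed (use z in simp)
    qed
  qed
qed

text \<open>Schur's product theorem for the entrywise square of a Gram matrix.\<close>

lemma gram_square_nonneg:
  fixes z :: "'i \<Rightarrow> 'a::complex_inner" and c :: "'i \<Rightarrow> real"
  assumes I: "finite I"
  shows "0 \<le> (\<Sum>i\<in>I. \<Sum>j\<in>I. c i * c j * (cmod (cinner (z i) (z j)))\<^sup>2)"
proof -
  obtain B where B: "finite B" "\<And>a b. a \<in> B \<Longrightarrow> b \<in> B \<Longrightarrow> cinner a b = of_bool (a = b)"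
    and z: "\<And>i. i \<in> I \<Longrightarrow> z i = (\<Sum>b\<in>B. cinner b (z i) *\<^sub>C b)"
    using finite_orthonormal_frame [of "z ` I"] I by auto
  define \<alpha> where "\<alpha> i b = cinner b (z i)" for i b
  have exp: "cinner (z i) (z j) = (\<Sum>b\<in>B. cnj (\<alpha> i b) * \<alpha> j b)" if "i \<in> I" for i j
  proof -
    have "cinner (z i) (z j) = cinner (\<Sum>b\<in>B. \<alpha> i b *\<^sub>C b) (z j)"
      using z [OF that] by (simp add: \<alpha>_def)
    then show ?thesis by (simp add: cinner_sum_left cinner_scaleC_left \<alpha>_def)
  qed
  \<comment> \<open>\<open>|\<langle>z_i, z_j\<rangle>|^2\<close> is the Hilbert-Schmidt product of
    the rank one matrices with entries \<open>cnj (\<alpha> i a) * \<alpha> i b\<close>; the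
    quadratic form is thus the squared Hilbert-Schmidt norm of their combination
    \<open>w\<close>.\<close>
  define w where "w a b = (\<Sum>i\<in>I. complex_of_real (c i) * (cnj (\<alpha> i a) * \<alpha> i b))" for a b
  have "complex_of_real (\<Sum>i\<in>I. \<Sum>j\<in>I. c i * c j * (cmod (cinner (z i) (z j)))\<^sup>2)
      = (\<Sum>i\<in>I. \<Sum>j\<in>I. complex_of_real (c i * c j) *
          ((\<Sum>a\<in>B. cnj (\<alpha> i a) * \<alpha> j a) * cnj (\<Sum>b\<in>B. cnj (\<alpha> i b) * \<alpha> j b)))"
    unfolding of_real_sum
    by (intro sum.cong refl) (simp add: exp complex_norm_square del: of_real_power)
  also have "\<dots> = (\<Sum>i\<in>I. \<Sum>j\<in>I. \<Sum>a\<in>B. \<Sum>b\<in>B.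
      (complex_of_real (c i) * (cnj (\<alpha> i a) * \<alpha> i b)) * (complex_of_real (c j) * (\<alpha> j a * cnj (\<alpha> j b))))"
    by (simp add: sum_product sum_distrib_left mult_ac)
  also have "\<dots> = (\<Sum>a\<in>B. \<Sum>b\<in>B. \<Sum>i\<in>I. \<Sum>j\<in>I.
      (complex_of_real (c i) * (cnj (\<alpha> i a) * \<alpha> i b)) * (complex_of_real (c j) * (\<alpha> j a * cnj (\<alpha> j b))))"
    by (simp only: sum.swap [of _ B I])
  also have "\<dots> = (\<Sum>a\<in>B. \<Sum>b\<in>B. w a b * cnj (w a b))"
    by (simp add: w_def sum_product)
  also have "\<dots> = complex_of_real (\<Sum>a\<in>B. \<Sum>b\<in>B. (cmod (w a b))\<^sup>2)"
    by (simp add: complex_norm_square del: of_real_power)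
  finally have "(\<Sum>i\<in>I. \<Sum>j\<in>I. c i * c j * (cmod (cinner (z i) (z j)))\<^sup>2)
      = (\<Sum>a\<in>B. \<Sum>b\<in>B. (cmod (w a b))\<^sup>2)"
    using of_real_eq_iff by blast
  then show ?thesis by (simp add: sum_nonneg)
qed

text \<open>Schur's theorem for the joint family, with weight \<open>1\<close> on the
  \<open>x i\<close> and \<open>-1\<close> on the \<open>y j\<close>: only the mixed sums get a
  negative sign.\<close>

lemma cross_gram_le:
  fixes x y :: "nat \<Rightarrow> 'a::complex_inner"
  shows "2 * (\<Sum>i<n. \<Sum>j<n. (cmod (cinner (x i) (y j)))\<^sup>2)
    \<le> (\<Sum>i<n. \<Sum>j<n. (cmod (cinner (x i) (x j)))\<^sup>2) + (\<Sum>i<n. \<Sum>j<n. (cmod (cinner (y i) (y j)))\<^sup>2)"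
proof -
  have "(\<Sum>i<n. \<Sum>j<n. (cmod (cinner (y i) (x j)))\<^sup>2) = (\<Sum>i<n. \<Sum>j<n. (cmod (cinner (x i) (y j)))\<^sup>2)"
  proof -
    have "cmod (cinner (y i) (x j)) = cmod (cinner (x j) (y i))" for i j
      by (metis cinner_commute complex_mod_cnj)
    then show ?thesis by (simp only:) (rule sum.swap)
  qed
  with gram_square_nonneg [of "{..<n} <+> {..<n}" "case_sum (\<lambda>_. 1) (\<lambda>_. -1)" "case_sum x y"]
  show ?thesis by (simp add: sum.Plus sum.distrib sum_negf sum_subtractf)
qed

text \<open>For \<open>k > 0\<close> each of the differences \<open>k\<close> and \<open>- k\<close>
  occurs \<open>n - k\<close> times. The sum over \<open>k\<close> counts the diagonal
  \<open>k = 0\<close> twice, which the subtracted term corrects.\<close>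

lemma sum_diff_table:
  fixes h :: "real \<Rightarrow> real"
  shows "(\<Sum>i<n. \<Sum>j<n. h (real j - real i))
    = (\<Sum>k<n. (real n - real k) * (h (real k) + h (- real k))) - real n * h 0"
proof (induction n)
  case (Suc n)
  have 1: "(\<Sum>i<n. h (real n - real i)) = (\<Sum>k<n. h (real (Suc k)))"
    using sum.nat_diff_reindex [of "\<lambda>k. h (real (Suc k))" n]
    by (simp add: of_nat_diff cong: sum.cong_simp)
  have 2: "(\<Sum>i<n. h (real i - real n)) = (\<Sum>k<n. h (- real (Suc k)))"
    using sum.nat_diff_reindex [of "\<lambda>k. h (- real (Suc k))" n]
    by (simp add: of_nat_diff cong: sum.cong_simp)
  have 3: "(\<Sum>k<n. h (real (Suc k))) = (\<Sum>k<Suc n. h (real k)) - h 0"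
    by (subst sum.lessThan_Suc_shift) simp
  have 4: "(\<Sum>k<n. h (- real (Suc k))) = (\<Sum>k<Suc n. h (- real k)) - h 0"
    by (subst sum.lessThan_Suc_shift) simp
  have "(\<Sum>i<Suc n. \<Sum>j<Suc n. h (real j - real i))
      = (\<Sum>i<n. \<Sum>j<n. h (real j - real i)) + (\<Sum>i<n. h (real n - real i))
        + (\<Sum>i<n. h (real i - real n)) + h 0"
    by (simp add: sum.distrib)
  also have "\<dots> = (\<Sum>k<n. (real n - real k) * (h (real k) + h (- real k))) - real n * h 0
      + (\<Sum>k<Suc n. h (real k) + h (- real k)) - h 0"
    by (simp add: Suc 1 2 3 4 sum.distrib del: of_nat_Suc sum.lessThan_Suc)
  also have "\<dots> = (\<Sum>k<Suc n. (real (Suc n) - real k) * (h (real k) + h (- real k)))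
      - real (Suc n) * h 0"
  proof -
    have "(\<Sum>k<n. (real n - real k) * f k) + (\<Sum>k<Suc n. f k)
        = (\<Sum>k<Suc n. (real (Suc n) - real k) * f k)" for f
    proof -
      have "(\<Sum>k<n. (real n - real k) * f k) + (\<Sum>k<Suc n. f k)
          = (\<Sum>k<Suc n. (real n - real k) * f k) + (\<Sum>k<Suc n. f k)" by simp
      also have "\<dots> = (\<Sum>k<Suc n. (real n - real k) * f k + f k)" by (rule sum.distrib [symmetric])
      also have "\<dots> = (\<Sum>k<Suc n. (real (Suc n) - real k) * f k)"
        by (intro sum.cong refl) (simp add: algebra_simps)
      finally show ?thesis .
    qed
    from this [of "\<lambda>k. h (real k) + h (- real k)"] show ?thesis
      by (simp add: distrib_right del: sum.lessThan_Suc)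
  qed
  finally show ?case .
qed simp

section \<open>Riemann sums and averages over a grid\<close>

lemma riemann_sum_tendsto:
  fixes g :: "real \<Rightarrow> real"
  assumes g: "continuous_on {0..T} g" and T: "T > 0"
  shows "(\<lambda>n. T / real n * (\<Sum>k<n. g (real k * T / real n))) \<longlonglongrightarrow> integral {0..T} g"
proof (rule LIMSEQ_I)
  fix e :: real assume e: "e > 0"
  have "uniformly_continuous_on {0..T} g"
    using g by (rule compact_uniformly_continuous) simp
  then obtain d where d: "d > 0"
    "\<And>x y. x \<in> {0..T} \<Longrightarrow> y \<in> {0..T} \<Longrightarrow> dist y x < d \<Longrightarrow> dist (g y) (g x) < e / (2 * T)"
    unfolding uniformly_continuous_on_def using e T
    by (metis divide_pos_pos mult_pos_pos zero_less_numeral)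
  obtain N where N: "real N > T / d" using reals_Archimedean2 by blast
  show "\<exists>N. \<forall>n\<ge>N. norm (T / real n * (\<Sum>k<n. g (real k * T / real n)) - integral {0..T} g) < e"
  proof (intro exI allI impI)
    fix n assume n: "n \<ge> Suc N"
    define \<delta> where "\<delta> = T / real n"
    have npos: "real n > 0" using n by simp
    have "T / d < real n" using N n by linarith
    then have \<delta>: "0 < \<delta>" "\<delta> < d" "real n * \<delta> = T"
      using T d(1) npos by (simp_all add: \<delta>_def field_simps)
    have int: "g integrable_on {0..real k * \<delta>}" if "k \<le> n" for k
    proof (rule integrable_continuous_interval, rule continuous_on_subset [OF g])
      have "real k * \<delta> \<le> real n * \<delta>" using that \<delta>(1) by (intro mult_right_mono) auto
      then show "{0..real k * \<delta>} \<subseteq> {0..T}" using \<delta>(3) by auto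
    qed
    \<comment> \<open>Each cell of length \<open>\<delta>\<close> contributes an error of at most
      \<open>\<delta> * (e / (2 * T))\<close>; the \<open>n\<close> cells have total length
      \<open>T\<close>, so the full error is at most \<open>e / 2\<close>.\<close>
    have "\<bar>\<delta> * (\<Sum>j<k. g (real j * \<delta>)) - integral {0..real k * \<delta>} g\<bar> \<le> real k * (\<delta> * (e / (2 * T)))"
      if "k \<le> n" for k
      using that
    proof (induction k)
      case (Suc k)
      let ?a = "real k * \<delta>" and ?b = "real (Suc k) * \<delta>"
      have ab: "0 \<le> ?a" "?a \<le> ?b" "?b - ?a = \<delta>" "?b \<le> T"
        using \<delta> Suc.prems mult_right_mono [of "real (Suc k)" "real n" \<delta>] by (auto simp: algebra_simps)
      have sub: "{?a..?b} \<subseteq> {0..T}" using ab by auto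
      have gi: "g integrable_on {?a..?b}"
        using continuous_on_subset [OF g sub] by (rule integrable_continuous_interval)
      have split: "integral {0..?b} g = integral {0..?a} g + integral {?a..?b} g"
        using Henstock_Kurzweil_Integration.integral_combine [OF ab(1,2) int [OF Suc.prems]] by simp
      have "norm (integral {?a..?b} (\<lambda>x. g ?a - g x)) \<le> e / (2 * T) * (?b - ?a)"
      proof (rule integral_bound)
        show "continuous_on {?a..?b} (\<lambda>x. g ?a - g x)"
          by (intro continuous_intros continuous_on_subset [OF g sub])
        show "norm (g ?a - g x) \<le> e / (2 * T)" if "x \<in> {?a..?b}" for x
        proof -
          have "dist ?a x < d" using that ab \<delta>(2) unfolding dist_real_def by auto
          moreover have "x \<in> {0..T}" "?a \<in> {0..T}" using that ab sub by (blast, auto)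
          ultimately have "dist (g ?a) (g x) < e / (2 * T)" by (intro d(2))
          then show ?thesis by (simp add: dist_norm)
        qed
      qed (use ab in auto)
      moreover have "integral {?a..?b} (\<lambda>x. g ?a - g x) = \<delta> * g ?a - integral {?a..?b} g"
        using ab gi by (subst integral_diff) auto
      ultimately have "\<bar>\<delta> * g ?a - integral {?a..?b} g\<bar> \<le> \<delta> * (e / (2 * T))"
        using ab(3) by (simp add: mult.commute)
      moreover have "\<bar>\<delta> * (\<Sum>j<k. g (real j * \<delta>)) - integral {0..?a} g\<bar> \<le> real k * (\<delta> * (e / (2 * T)))"
        using Suc by simp
      moreover have "\<delta> * (\<Sum>j<Suc k. g (real j * \<delta>)) - integral {0..?b} g
          = (\<delta> * (\<Sum>j<k. g (real j * \<delta>)) - integral {0..?a} g) + (\<delta> * g ?a - integral {?a..?b} g)"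
        by (simp only: split sum.lessThan_Suc distrib_left)
      moreover have "real (Suc k) * (\<delta> * (e / (2 * T))) = real k * (\<delta> * (e / (2 * T))) + \<delta> * (e / (2 * T))"
        by (simp add: distrib_right add_divide_distrib)
      ultimately show ?case by linarith
    qed simp
    from this [of n] have "\<bar>\<delta> * (\<Sum>j<n. g (real j * \<delta>)) - integral {0..T} g\<bar> \<le> e / 2"
      using \<delta>(3) T by (simp add: mult.assoc [symmetric])
    then show "norm (T / real n * (\<Sum>k<n. g (real k * T / real n)) - integral {0..T} g) < e"
      using e by (simp add: \<delta>_def)
  qed
qed

lemma continuous_on_reflect:
  fixes h :: "real \<Rightarrow> 'b::topological_space"
  assumes "continuous_on UNIV h" shows "continuous_on S (\<lambda>r. h (- r))"
  using continuous_on_compose2 [OF assms continuous_on_minus [OF continuous_on_id], of S] by simp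

text \<open>The limit is \<open>1/T\<close> times the double integral of \<open>h (s - r)\<close> over \<open>[0, T] \<times> [0, T]\<close>.\<close>

lemma grid_average_tendsto:
  fixes h :: "real \<Rightarrow> real"
  assumes h: "continuous_on UNIV h" and T: "T > 0"
  shows "(\<lambda>n. T / (real n)\<^sup>2 * (\<Sum>i<n. \<Sum>j<n. h ((real j - real i) * (T / real n))))
    \<longlonglongrightarrow> integral {0..T} (\<lambda>r. (1 - r / T) * (h r + h (- r)))"
proof -
  let ?g = "\<lambda>r. (1 - r / T) * (h r + h (- r))"
  have cont: "continuous_on {0..T} ?g"
    using T by (intro continuous_intros continuous_on_reflect h continuous_on_subset [OF h]) auto
  \<comment> \<open>The term removed is the diagonal that \<open>sum_diff_table\<close> corrects
    for; it is of order \<open>1 / n\<close> and vanishes in the limit.\<close>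
  have *: "T / real n * (\<Sum>k<n. ?g (real k * T / real n)) - T * h 0 * (1 / real n)
      = T / (real n)\<^sup>2 * (\<Sum>i<n. \<Sum>j<n. h ((real j - real i) * (T / real n)))" if "n > 0" for n
  proof -
    have "?g (real k * T / real n)
        = (real n - real k) * (h (real k * (T / real n)) + h (- real k * (T / real n))) / real n" for k
      using T that by (simp add: field_simps)
    then have "(\<Sum>k<n. ?g (real k * T / real n))
        = (\<Sum>k<n. (real n - real k) * (h (real k * (T / real n)) + h (- real k * (T / real n)))) / real n"
      by (simp only: sum_divide_distrib)
    moreover have "T / real n * (X / real n) - T * h 0 * (1 / real n)
        = T / (real n)\<^sup>2 * (X - real n * h (0 * (T / real n)))" for X
      using that by (simp add: power2_eq_square field_simps)
    ultimately show ?thesis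
      unfolding sum_diff_table [of "\<lambda>x. h (x * (T / real n))" n] by (simp only:)
  qed
  have "(\<lambda>n. T / real n * (\<Sum>k<n. ?g (real k * T / real n)) - T * h 0 * (1 / real n))
      \<longlonglongrightarrow> integral {0..T} ?g - T * h 0 * 0"
    by (intro tendsto_intros riemann_sum_tendsto cont T lim_1_over_n)
  then show ?thesis unfolding mult_zero_right diff_zero
    by (rule Lim_transform_eventually) (use * in \<open>auto intro: eventually_sequentiallyI [of 1]\<close>)
qed

context self_adjoint_operator
begin

section \<open>Correlations of vectors of \<open>E_space H\<close> along the group\<close>

lemma continuous_on_cinner_grp: "continuous_on S (\<lambda>t. (cmod (cinner f (grp t g)))\<^sup>2)"
  by (intro continuous_intros continuous_on_grp)

text \<open>By the group law, a correlation at time \<open>s_j - s_i\<close> is the inner product of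
  orbit points at times \<open>s_i\<close> and \<open>s_j\<close>. The grid sums are therefore Gram
  sums, and \<open>cross_gram_le\<close> survives the limit.\<close>

lemma cross_average_le:
  assumes T: "T > 0"
  defines "J \<equiv> \<lambda>f g. integral {0..T} (\<lambda>r. (1 - r / T) *
    ((cmod (cinner f (grp r g)))\<^sup>2 + (cmod (cinner f (grp (- r) g)))\<^sup>2))"
  shows "2 * J f g \<le> J f f + J g g"
proof -
  define S where "S f g n = T / (real n)\<^sup>2 *
    (\<Sum>i<n. \<Sum>j<n. (cmod (cinner f (grp ((real j - real i) * (T / real n)) g)))\<^sup>2)" for f g n
  have lim: "S f g \<longlonglongrightarrow> J f g" for f g
    unfolding S_def J_def by (rule grid_average_tendsto [OF continuous_on_cinner_grp T])
  have eq: "cinner f (grp ((real j - real i) * \<delta>) g) = cinner (grp (real i * \<delta>) f) (grp (real j * \<delta>) g)"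
    for f g i j \<delta>
    by (simp add: cinner_grp flip: grp_plus) (simp add: left_diff_distrib)
  have "2 * S f g n \<le> S f f n + S g g n" for n
  proof -
    have "T / (real n)\<^sup>2 * (2 * (\<Sum>i<n. \<Sum>j<n. (cmod (cinner f (grp ((real j - real i) * (T / real n)) g)))\<^sup>2))
        \<le> T / (real n)\<^sup>2 * ((\<Sum>i<n. \<Sum>j<n. (cmod (cinner f (grp ((real j - real i) * (T / real n)) f)))\<^sup>2)
          + (\<Sum>i<n. \<Sum>j<n. (cmod (cinner g (grp ((real j - real i) * (T / real n)) g)))\<^sup>2))"
      unfolding eq using T by (intro mult_left_mono cross_gram_le) simp
    then show ?thesis by (simp only: S_def distrib_left mult.left_commute)
  qed
  then show ?thesis
    by (intro LIMSEQ_le [OF tendsto_mult_left [OF lim] tendsto_add [OF lim lim]]) auto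
qed

lemma psi_eq: "psi H u t = cinner u (grp t u)"
  by (simp add: psi_def exp_i_eq_grp)

lemma cmod_psi_minus: "cmod (cinner u (grp (- t) u)) = cmod (cinner u (grp t u))"
  by (metis cinner_commute cinner_grp complex_mod_cnj minus_minus)

lemma E_space_bound:
  assumes "u \<in> E_space H"
  shows "\<exists>M. \<forall>T. integral {0..T} (\<lambda>t. (cmod (cinner u (grp t u)))\<^sup>2) \<le> M"
proof -
  define N where "N = (\<integral>\<^sup>+ t. ennreal ((cmod (psi H u t))\<^sup>2) \<partial>lborel)"
  have N: "N < \<infinity>" using assms by (simp add: E_space_def N_def)
  have "integral {0..T} (\<lambda>t. (cmod (cinner u (grp t u)))\<^sup>2) \<le> enn2real N" for T
  proof -
    let ?f = "\<lambda>t. (cmod (cinner u (grp t u)))\<^sup>2"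
    have "(?f has_integral integral {0..T} ?f) {0..T}"
      by (intro integrable_integral integrable_continuous_interval continuous_on_cinner_grp)
    then have "ennreal (integral {0..T} ?f) = (\<integral>\<^sup>+ t. indicator {0..T} t * ?f t \<partial>lborel)"
      by (intro nn_integral_has_integral_lebesgue [symmetric]) auto
    also have "\<dots> \<le> N"
      unfolding N_def psi_eq by (intro nn_integral_mono) (auto simp: indicator_def)
    finally have "ennreal (integral {0..T} ?f) \<le> N" .
    then have "enn2real (ennreal (integral {0..T} ?f)) \<le> enn2real N"
      using N by (intro enn2real_mono) (auto simp: less_top)
    then show ?thesis
      by (subst (asm) enn2real_ennreal) (auto intro!: integral_nonneg integrable_continuous_interval
          continuous_on_cinner_grp)
  qed
  then show ?thesis by blast
qed

text \<open>The weight in \<open>cross_average_le\<close> vanishes at the end of its window. On the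
  window \<open>[0, 2T]\<close> it is at least \<open>1/2\<close> throughout \<open>[0, T]\<close>,
  while for \<open>f = g\<close> it is at most \<open>1\<close> and the correlations are even in
  time.\<close>

lemma cross_correlation_bound:
  assumes "f \<in> E_space H" "g \<in> E_space H"
  shows "\<exists>M. \<forall>T>0. integral {0..T} (\<lambda>t. (cmod (cinner f (grp t g)))\<^sup>2) \<le> M"
proof -
  let ?q = "\<lambda>f g t. (cmod (cinner f (grp t g)))\<^sup>2"
  obtain M M' where M: "\<And>T. integral {0..T} (?q f f) \<le> M" "\<And>T. integral {0..T} (?q g g) \<le> M'"
    using E_space_bound [OF assms(1)] E_space_bound [OF assms(2)] by blast
  have cont: "continuous_on S (\<lambda>r. ?q f g (- r))" for S f g
    by (rule continuous_on_reflect [OF continuous_on_cinner_grp])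
  have int: "(\<lambda>r. (1 - r / T) * (?q f g r + ?q f g (- r))) integrable_on {a..b}" for f g T a b
  proof -
    have "continuous_on {a..b} (\<lambda>r. 1 - r / T)"
      unfolding divide_inverse by (intro continuous_intros)
    then show ?thesis
      by (intro integrable_continuous_interval continuous_on_mult continuous_on_add cont
          continuous_on_cinner_grp)
  qed
  have diag: "integral {0..T} (\<lambda>r. (1 - r / T) * (?q f f r + ?q f f (- r)))
      \<le> 2 * integral {0..T} (?q f f)" if "T > 0" for f T
  proof -
    have "integral {0..T} (\<lambda>r. (1 - r / T) * (?q f f r + ?q f f (- r)))
        \<le> integral {0..T} (\<lambda>r. 2 * ?q f f r)"
    proof (intro integral_le int)
      show "(1 - r / T) * (?q f f r + ?q f f (- r)) \<le> 2 * ?q f f r" if "r \<in> {0..T}" for r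
        using that \<open>T > 0\<close> mult_right_mono [of "1 - r / T" 1 "2 * ?q f f r"]
        by (simp add: cmod_psi_minus)
      show "(\<lambda>r. 2 * ?q f f r) integrable_on {0..T}"
        by (intro integrable_continuous_interval continuous_intros continuous_on_cinner_grp)
    qed
    then show ?thesis by simp
  qed
  have "integral {0..T} (?q f g) \<le> 2 * (M + M')" if T: "T > 0" for T
  proof -
    let ?G = "\<lambda>r. (1 - r / (2 * T)) * (?q f g r + ?q f g (- r))"
    have pos: "0 \<le> ?G r" if "r \<in> {0..2 * T}" for r
      using that T by (intro mult_nonneg_nonneg) (auto simp: field_simps)
    have "integral {0..T} (?q f g) \<le> integral {0..T} (\<lambda>r. 2 * ?G r)"
    proof (rule integral_le)
      show "?q f g integrable_on {0..T}"
        by (intro integrable_continuous_interval continuous_on_cinner_grp)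
      show "(\<lambda>r. 2 * ?G r) integrable_on {0..T}"
        using int by (intro integrable_on_mult_right)
      show "?q f g r \<le> 2 * ?G r" if "r \<in> {0..T}" for r
      proof -
        have "1 / 2 \<le> 1 - r / (2 * T)" using that T by (auto simp: field_simps)
        then have "1 / 2 * (?q f g r + ?q f g (- r)) \<le> ?G r" by (intro mult_right_mono) auto
        moreover have "0 \<le> ?q f g (- r)" by simp
        ultimately show ?thesis by argo
      qed
    qed
    also have "\<dots> = 2 * integral {0..T} ?G" by simp
    also have "\<dots> \<le> 2 * integral {0..2 * T} ?G"
      using pos T int by (intro mult_left_mono integral_subset_le) auto
    also have "\<dots> \<le> 2 * (M + M')"
      using cross_average_le [of "2 * T" f g] diag [of "2 * T" f] diag [of "2 * T" g] T
        M(1) [of "2 * T"] M(2) [of "2 * T"] by simp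
    finally show ?thesis .
  qed
  then show ?thesis by blast
qed

end

section \<open>The commutator form\<close>

context self_adjoint_operator
begin

lemma res_tendsto_id_compose: "((\<lambda>n. res (h n) y) \<longlongrightarrow> y) F" if "(h \<longlongrightarrow> 0) F"
proof -
  have "isCont (\<lambda>h. res h y) 0" unfolding isCont_def using res_tendsto_id by simp
  from isCont_tendsto_compose [OF this that] show ?thesis by simp
qed

text \<open>The bounded operators \<open>A (1 - \<i>hA)\<^sup>-\<^sup>1\<close>, which converge to \<open>A\<close> on its domain as \<open>h\<close> tends to 0.\<close>

definition yosida :: "real \<Rightarrow> 'a \<Rightarrow> 'a" where
  "yosida h w = (1 / (\<i> * complex_of_real h)) *\<^sub>C (res h w - w)"

lemma yosida_eq: "h \<noteq> 0 \<Longrightarrow> yosida h w = app H (res h w)"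
  by (simp add: yosida_def scaleC_scaleC flip: app_res_eq)

lemma yosida_dom: "h \<noteq> 0 \<Longrightarrow> w \<in> \<D> \<Longrightarrow> yosida h w = res h (app H w)"
  by (simp add: yosida_eq app_res)

lemma cinner_yosida: "cinner (yosida h a) b = cinner a (yosida (- h) b)"
  by (simp add: yosida_def cinner_scaleC_left cinner_scaleC_right cinner_diff_left
      cinner_diff_right cinner_res)

lemma yosida_tendsto:
  assumes "(h \<longlongrightarrow> 0) F" "\<And>n. h n \<noteq> 0" "w \<in> \<D>"
  shows "((\<lambda>n. yosida (h n) w) \<longlongrightarrow> app H w) F"
  using assms by (simp add: yosida_dom res_tendsto_id_compose)

lemma bounded_op_yosida: "bounded_op (yosida h)"
proof (rule bounded_opI [of _ "2 * cmod (1 / (\<i> * complex_of_real h))"])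
  show "norm (yosida h w) \<le> 2 * cmod (1 / (\<i> * complex_of_real h)) * norm w" for w
  proof -
    have "norm (res h w - w) \<le> 2 * norm w"
      using norm_triangle_ineq4 [of "res h w" w] norm_res_le [of h w] by simp
    then have "cmod (1 / (\<i> * complex_of_real h)) * norm (res h w - w)
        \<le> cmod (1 / (\<i> * complex_of_real h)) * (2 * norm w)"
      by (intro mult_left_mono) auto
    then show ?thesis by (simp add: yosida_def mult_ac)
  qed
  show "yosida h (x + y) = yosida h x + yosida h y" for x y
    by (simp add: yosida_def res_add add_diff_add scaleC_add_right)
  show "yosida h (a *\<^sub>C x) = a *\<^sub>C yosida h x" for a x
    by (simp add: yosida_def res_scaleC scaleC_scaleC scaleC_diff_right mult.commute [of a])
qed

end

section \<open>The bounded commutator of \<open>A\<close> with a resolvent of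
  \<open>H\<close>\<close>

locale C1_pair = A: self_adjoint_operator A + H: self_adjoint_operator H
  for A H :: "'a::complex_hilbert unbounded_op" +
  fixes z :: complex
  assumes z: "z \<in> resolvent_set H" and C1: "C1_bounded A (resolvent H z)"
begin

abbreviation "S \<equiv> resolvent H z"

lemma bounded_op_S: "bounded_op S"
  and bij_S: "bij_betw (\<lambda>u. app H u - z *\<^sub>C u) (dom_op H) UNIV"
  using z by (auto simp: resolvent_set_def)

lemmas S_add = bounded_op_add [OF bounded_op_S]
  and S_diff = bounded_op_diff [OF bounded_op_S]
  and S_scaleC = bounded_op_scaleC [OF bounded_op_S]
  and S_tendsto = bounded_op_tendsto [OF bounded_op_S]

lemma S_dom: "S y \<in> dom_op H"
  and shift_S: "app H (S y) - z *\<^sub>C S y = y"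
proof -
  have "y \<in> (\<lambda>u. app H u - z *\<^sub>C u) ` dom_op H"
    using bij_S by (simp add: bij_betw_def)
  from inv_into_into [OF this] f_inv_into_f [OF this]
  show "S y \<in> dom_op H" "app H (S y) - z *\<^sub>C S y = y" by (simp_all add: resolvent_def)
qed

lemma S_shift: "v \<in> dom_op H \<Longrightarrow> S (app H v - z *\<^sub>C v) = v"
  using inv_into_f_f [of "\<lambda>u. app H u - z *\<^sub>C u" "dom_op H" v] bij_S
  by (simp add: resolvent_def bij_betw_def)

lemma app_S: "app H (S y) = y + z *\<^sub>C S y"
  using shift_S [of y] by (simp add: diff_eq_eq)

lemma cinner_shift_S:
  assumes u: "u \<in> dom_op H"
  shows "cinner (app H u - cnj z *\<^sub>C u) (S y) = cinner u y"
  using H.symmetric [OF u S_dom, of y] arg_cong [OF shift_S [of y], of "cinner u"]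
  by (simp add: cinner_diff_left cinner_diff_right cinner_scaleC_left cinner_scaleC_right)

lemma form_bounded:
  "\<exists>K\<ge>0. \<forall>u\<in>dom_op A. \<forall>v\<in>dom_op A.
    cmod (cinner (app A u) (S v) - cinner u (S (app A v))) \<le> K * norm u * norm v"
proof -
  define B where "B u v = cinner (app A u) (S v) - cinner u (S (app A v))" for u v
  have cont: "continuous_on (dom_op A \<times> dom_op A) (\<lambda>(u, v). B u v)"
    using C1 by (simp add: C1_bounded_def B_def)
  have B_scale: "B (r *\<^sub>R u) (s *\<^sub>R v) = complex_of_real (r * s) * B u v"
    if "u \<in> dom_op A" "v \<in> dom_op A" for r s u v
    using that by (simp add: B_def scaleR_scaleC A.app_scaleC S_scaleC cinner_scaleC_left
        cinner_scaleC_right algebra_simps)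
  have B0: "B 0 0 = 0" using B_scale [OF A.dom_zero A.dom_zero, of 0 0] by simp
  obtain d where d: "d > 0" "\<And>u v. u \<in> dom_op A \<Longrightarrow> v \<in> dom_op A \<Longrightarrow>
      dist (u, v) (0, 0) < d \<Longrightarrow> cmod (B u v) < 1"
    using cont [unfolded continuous_on_iff, rule_format, of "(0, 0)" 1] A.dom_zero B0
    by (auto simp: dist_norm)
  have "cmod (B u v) \<le> 9 / d\<^sup>2 * norm u * norm v" if uv: "u \<in> dom_op A" "v \<in> dom_op A" for u v
  proof (cases "u = 0 \<or> v = 0")
    case True
    then show ?thesis using B_scale [OF uv, of 0 1] B_scale [OF uv, of 1 0] by auto
  next
    case False
    \<comment> \<open>Homogeneity turns continuity at the origin into a bound: both vectors are
      rescaled to norm \<open>d / 3\<close>, the pair then has norm below \<open>d\<close>, and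
      undoing the scaling produces \<open>9 / d^2\<close>.\<close>
    define r where "r = d / (3 * norm u)"
    define s where "s = d / (3 * norm v)"
    have rs: "r > 0" "s > 0" using False d(1) by (auto simp: r_def s_def)
    have "norm (r *\<^sub>R u, s *\<^sub>R v) \<le> norm (r *\<^sub>R u) + norm (s *\<^sub>R v)"
      by (rule norm_Pair_le)
    also have "\<dots> < d" using False d(1) by (simp add: r_def s_def)
    finally have "cmod (B (r *\<^sub>R u) (s *\<^sub>R v)) < 1"
      using uv by (intro d(2)) (auto simp: scaleR_scaleC A.dom_scaleC dist_norm simp flip: zero_prod_def)
    then have "r * s * cmod (B u v) < 1"
      using rs by (simp add: B_scale [OF uv] norm_mult)
    then have "cmod (B u v) < 1 / (r * s)"
      using rs by (simp add: field_simps)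
    also have "1 / (r * s) = 9 / d\<^sup>2 * norm u * norm v"
      using False d(1) by (simp add: r_def s_def power2_eq_square field_simps)
    finally show ?thesis by simp
  qed
  then show ?thesis unfolding B_def by (intro exI [of _ "9 / d\<^sup>2"]) auto
qed

text \<open>The form bound makes \<open>u \<mapsto> \<langle>Au, Sv\<rangle>\<close> bounded on
  \<open>dom_op A\<close>, so \<open>S v\<close> lies in the domain of the adjoint of
  \<open>A\<close>, which is \<open>A\<close> itself.\<close>

lemma S_dom_A:
  assumes v: "v \<in> dom_op A" shows "S v \<in> dom_op A"
proof -
  obtain K where K: "K \<ge> 0" "\<And>u v. u \<in> dom_op A \<Longrightarrow> v \<in> dom_op A \<Longrightarrow>
      cmod (cinner (app A u) (S v) - cinner u (S (app A v))) \<le> K * norm u * norm v"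
    using form_bounded by blast
  have bound: "cmod (cinner (app A u) (S v)) \<le> (K * norm v + norm (S (app A v))) * norm u"
    if u: "u \<in> dom_op A" for u
    using K(2) [OF u v] cmod_cinner_le [of u "S (app A v)"]
      norm_triangle_ineq [of "cinner (app A u) (S v) - cinner u (S (app A v))" "cinner u (S (app A v))"]
    by (simp add: algebra_simps)
  obtain w where "\<And>u. u \<in> dom_op A \<Longrightarrow> cinner (app A u) (S v) = cinner u w"
    using riesz_antilinear [of "dom_op A" "\<lambda>u. cinner (app A u) (S v)", OF A.dom_zero A.dom_add
        A.dom_scaleC _ _ bound] K(1)
    by (auto simp: A.app_add A.app_scaleC cinner_add_left cinner_scaleC_left)
  then show ?thesis by (rule A.adjoint_domain(1))
qed

text \<open>The commutator \<open>[A, S]\<close>, an actual operator on \<open>dom_op A\<close>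
  since \<open>S\<close> preserves that domain.\<close>

definition T :: "'a \<Rightarrow> 'a" where
  "T v = app A (S v) - S (app A v)"

lemma T_add: "u \<in> dom_op A \<Longrightarrow> v \<in> dom_op A \<Longrightarrow> T (u + v) = T u + T v"
  by (simp add: T_def S_add A.app_add S_dom_A)

lemma T_scaleC: "v \<in> dom_op A \<Longrightarrow> T (a *\<^sub>C v) = a *\<^sub>C T v"
  by (simp add: T_def S_scaleC A.app_scaleC S_dom_A scaleC_diff_right)

lemma T_bounded: "\<exists>K\<ge>0. \<forall>v\<in>dom_op A. norm (T v) \<le> K * norm v"
proof -
  obtain K where K: "K \<ge> 0" "\<And>u v. u \<in> dom_op A \<Longrightarrow> v \<in> dom_op A \<Longrightarrow>
      cmod (cinner (app A u) (S v) - cinner u (S (app A v))) \<le> K * norm u * norm v"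
    using form_bounded by blast
  have "norm (T v) \<le> K * norm v" if v: "v \<in> dom_op A" for v
  proof -
    have eq: "cinner u (T v) = cinner (app A u) (S v) - cinner u (S (app A v))"
      if "u \<in> dom_op A" for u
      using A.symmetric [OF that S_dom_A [OF v]] by (simp add: T_def cinner_diff_right)
    obtain w where w: "\<And>u. u \<in> dom_op A \<Longrightarrow> cinner u (T v) = cinner u w" "norm w \<le> K * norm v"
      using riesz_antilinear [of "dom_op A" "\<lambda>u. cinner u (T v)" "K * norm v", OF A.dom_zero
          A.dom_add A.dom_scaleC] K(1) K(2) [OF _ v]
      by (auto simp: cinner_add_left cinner_scaleC_left eq mult_ac)
    with cinner_ext_dense_right [OF A.dom_dense] show ?thesis by metis
  qed
  then show ?thesis using K(1) by blast
qed

lemma T_adjoint: "\<exists>Q. bounded_op Q \<and> (\<forall>y. \<forall>v\<in>dom_op A. cinner y (T v) = cinner (Q y) v)"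
proof -
  obtain K where K: "K \<ge> 0" "\<And>v. v \<in> dom_op A \<Longrightarrow> norm (T v) \<le> K * norm v"
    using T_bounded by blast
  have "\<exists>w. (\<forall>v\<in>dom_op A. cinner (T v) y = cinner v w) \<and> norm w \<le> K * norm y" for y
  proof (rule riesz_antilinear [OF A.dom_zero A.dom_add A.dom_scaleC])
    show "cmod (cinner (T v) y) \<le> K * norm y * norm v" if "v \<in> dom_op A" for v
    proof -
      have "norm (T v) * norm y \<le> K * norm v * norm y"
        using K(2) [OF that] by (intro mult_right_mono) auto
      then show ?thesis using cmod_cinner_le [of "T v" y] by (simp add: mult_ac)
    qed
  qed (use K(1) in \<open>simp_all add: T_add T_scaleC cinner_add_left cinner_scaleC_left\<close>)
  then obtain Q where Q: "\<And>y v. v \<in> dom_op A \<Longrightarrow> cinner (T v) y = cinner v (Q y)"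
    "\<And>y. norm (Q y) \<le> K * norm y" by metis
  have "bounded_op Q"
  proof (rule bounded_opI [OF _ _ Q(2)])
    show "Q (x + y) = Q x + Q y" for x y
      by (rule cinner_ext_dense_right [OF A.dom_dense]) (simp add: cinner_add_right flip: Q(1))
    show "Q (a *\<^sub>C x) = a *\<^sub>C Q x" for a x
      by (rule cinner_ext_dense_right [OF A.dom_dense]) (simp add: cinner_scaleC_right flip: Q(1))
  qed
  moreover have "cinner y (T v) = cinner (Q y) v" if "v \<in> dom_op A" for y v
    using Q(1) [OF that, of y] by (metis cinner_commute)
  ultimately show ?thesis by blast
qed

text \<open>The adjoint of the bounded operator \<open>[A, S]\<close>; it spares the extension of \<open>T\<close> from the domain of
  \<open>A\<close> to the whole space.\<close>

definition Q :: "'a \<Rightarrow> 'a" where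
  "Q = (SOME Q. bounded_op Q \<and> (\<forall>y. \<forall>v\<in>dom_op A. cinner y (T v) = cinner (Q y) v))"

lemma bounded_op_Q: "bounded_op Q"
  and cinner_Q: "v \<in> dom_op A \<Longrightarrow> cinner (Q y) v = cinner y (T v)"
  using someI_ex [OF T_adjoint] unfolding Q_def by auto

lemmas Q_tendsto = bounded_op_tendsto [OF bounded_op_Q]

text \<open>The rule for the commutator with an inverse, since \<open>A.yosida h\<close> is an
  affine function of \<open>A.res h\<close>. The inner resolvent maps into \<open>dom_op A\<close>,
  where \<open>T\<close> is the commutator, so \<open>w\<close> may be arbitrary.\<close>

lemma yosida_commutator:
  assumes h: "h \<noteq> 0"
  shows "A.yosida h (S w) - S (A.yosida h w) = A.res h (T (A.res h w))"
proof -
  define x where "x = A.res h w"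
  have x: "x \<in> dom_op A" "S x \<in> dom_op A" using h by (simp_all add: x_def A.res_dom S_dom_A)
  let ?c = "\<i> * complex_of_real h"
  have w: "w = x - ?c *\<^sub>C app A x" by (simp add: x_def A.shift_res)
  have "S w = (S x - ?c *\<^sub>C app A (S x)) + ?c *\<^sub>C T x"
    by (simp add: w S_diff S_scaleC T_def scaleC_diff_right)
  then have "A.res h (S w) = S x + ?c *\<^sub>C A.res h (T x)"
    using x by (simp add: A.res_add A.res_scaleC A.res_shift)
  moreover have "S w = S x - ?c *\<^sub>C S (app A x)" by (simp add: w S_diff S_scaleC)
  ultimately have "A.yosida h (S w) = A.res h (T x) + S (app A x)"
    using h by (simp add: A.yosida_def scaleC_scaleC flip: scaleC_add_right)
  then show ?thesis using h by (simp add: A.yosida_eq x_def)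
qed

section \<open>The form \<open>[A, H]\<close> expressed through the bounded commutator\<close>

definition \<epsilon> :: "nat \<Rightarrow> real" where
  "\<epsilon> n = inverse (real (Suc n))"

lemma \<epsilon>: "\<epsilon> \<longlonglongrightarrow> 0" "\<epsilon> n \<noteq> 0" "(\<lambda>n. - \<epsilon> n) \<longlonglongrightarrow> 0"
  using LIMSEQ_inverse_real_of_nat tendsto_minus [OF LIMSEQ_inverse_real_of_nat]
  by (simp_all add: \<epsilon>_def [abs_def])

text \<open>Formally this is \<open>[A, S] = - S [A, H] S\<close>, tested on
  \<open>(H - cnj z) u\<close> and \<open>v' = (H - z) v\<close>. Since \<open>v'\<close> may lie
  outside \<open>dom_op A\<close>, \<open>T\<close> is traded for \<open>Q\<close>, and
  \<open>A\<close> for its Yosida approximants, whose commutators with \<open>S\<close> act on the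
  whole space.\<close>

lemma commutator_via_Q:
  assumes u: "u \<in> dom_op A" "u \<in> dom_op H" and v: "v \<in> dom_op A" "v \<in> dom_op H"
  shows "cinner (app A u) (app H v) - cinner (app H u) (app A v)
    = - cinner (Q (app H u - cnj z *\<^sub>C u)) (app H v - z *\<^sub>C v)"
proof -
  define u' where "u' = app H u - cnj z *\<^sub>C u"
  define v' where "v' = app H v - z *\<^sub>C v"
  have Sv': "S v' = v" using v by (simp add: v'_def S_shift)
  have "(\<lambda>n. cinner (Q (A.res (- \<epsilon> n) u')) (A.res (\<epsilon> n) v')) \<longlonglongrightarrow> cinner (Q u') v'"
    by (intro tendsto_cinner Q_tendsto A.res_tendsto_id_compose \<epsilon>)
  moreover have "(\<lambda>n. cinner u' (A.yosida (\<epsilon> n) v) - cinner (A.yosida (- \<epsilon> n) u) v')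
      \<longlonglongrightarrow> cinner u' (app A v) - cinner (app A u) v'"
    using \<epsilon>(2) u v by (intro tendsto_diff tendsto_cinner A.yosida_tendsto tendsto_const \<epsilon>(1,3)) auto
  moreover have "cinner (Q (A.res (- \<epsilon> n) u')) (A.res (\<epsilon> n) v')
      = cinner u' (A.yosida (\<epsilon> n) v) - cinner (A.yosida (- \<epsilon> n) u) v'" for n
  proof -
    have "cinner (Q (A.res (- \<epsilon> n) u')) (A.res (\<epsilon> n) v') = cinner u' (A.res (\<epsilon> n) (T (A.res (\<epsilon> n) v')))"
      using \<epsilon>(2) [of n] by (simp add: cinner_Q A.res_dom A.cinner_res)
    also have "\<dots> = cinner u' (A.yosida (\<epsilon> n) v) - cinner u' (S (A.yosida (\<epsilon> n) v'))"
      using \<epsilon>(2) [of n] by (simp add: Sv' cinner_diff_right flip: yosida_commutator)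
    also have "cinner u' (S (A.yosida (\<epsilon> n) v')) = cinner u (A.yosida (\<epsilon> n) v')"
      unfolding u'_def by (rule cinner_shift_S [OF u(2)])
    finally show ?thesis by (simp add: A.cinner_yosida)
  qed
  ultimately have "cinner (Q u') v' = cinner u' (app A v) - cinner (app A u) v'"
    by (simp add: LIMSEQ_unique)
  also have "\<dots> = cinner (app H u) (app A v) - cinner (app A u) (app H v)"
    using A.symmetric [OF u(1) v(1)]
    by (simp add: u'_def v'_def cinner_diff_left cinner_diff_right cinner_scaleC_left cinner_scaleC_right)
  finally show ?thesis by (simp add: u'_def v'_def)
qed

text \<open>\<open>S\<close> maps the dense set \<open>dom_op A\<close> into both domains, and
  \<open>H S = 1 + zS\<close> is bounded, so approximating \<open>(H - z) u\<close> within
  \<open>dom_op A\<close> suffices.\<close>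

lemma graph_dense:
  assumes u: "u \<in> dom_op H"
  shows "\<exists>f. (\<forall>n::nat. f n \<in> dom_op A \<inter> dom_op H) \<and> (\<lambda>n. (f n, app H (f n))) \<longlonglongrightarrow> (u, app H u)"
proof -
  define u' where "u' = app H u - z *\<^sub>C u"
  obtain g where g: "\<And>n::nat. g n \<in> dom_op A" "g \<longlonglongrightarrow> u'"
    using A.dom_dense by (metis UNIV_I closure_sequential)
  have u_eq: "u = S u'" using u by (simp add: u'_def S_shift)
  have "(\<lambda>n. (S (g n), app H (S (g n)))) \<longlonglongrightarrow> (u, app H u)"
    unfolding u_eq app_S by (intro tendsto_intros S_tendsto g)
  then show ?thesis using g(1) S_dom S_dom_A by (intro exI [of _ "\<lambda>n. S (g n)"]) auto
qed

text \<open>The explicit form satisfies the definite description. Any other candidate agrees with it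
  on the intersection of the domains, hence on \<open>dom_op H\<close> by \<open>graph_dense\<close>
  and continuity; off that domain both are zero by convention.\<close>

lemma commutator_form_eq:
  assumes u: "u \<in> dom_op H" and v: "v \<in> dom_op H"
  shows "commutator_form A H u v = - cinner (Q (app H u - cnj z *\<^sub>C u)) (app H v - z *\<^sub>C v)"
proof -
  define F where "F u v = (if u \<in> dom_op H \<and> v \<in> dom_op H
    then - cinner (Q (app H u - cnj z *\<^sub>C u)) (app H v - z *\<^sub>C v) else 0)" for u v
  have "commutator_form A H = F"
    unfolding commutator_form_def
  proof (rule the_equality)
    have "sesquilinear_on (dom_op H) F"
      unfolding sesquilinear_on_def
      by (auto simp: F_def H.dom_add H.dom_scaleC H.app_add H.app_scaleC scaleC_add_right
          bounded_op_add [OF bounded_op_Q] bounded_op_diff [OF bounded_op_Q]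
          bounded_op_scaleC [OF bounded_op_Q] cinner_add_left cinner_add_right cinner_diff_left
          cinner_diff_right cinner_scaleC_left cinner_scaleC_right algebra_simps)
    moreover have "graph_continuous_form H F"
    proof -
      have "continuous_on (op_graph H \<times> op_graph H)
          (\<lambda>p. - cinner (Q (snd (fst p) - cnj z *\<^sub>C fst (fst p))) (snd (snd p) - z *\<^sub>C fst (snd p)))"
        by (intro continuous_intros
            bounded_linear.continuous_on [OF bounded_op_bounded_linear [OF bounded_op_Q]])
      then show ?thesis
        unfolding graph_continuous_form_def
        by (rule continuous_on_eq) (auto simp: op_graph_def F_def)
    qed
    ultimately show "sesquilinear_on (dom_op H) F \<and> graph_continuous_form H F
     \<and> (\<forall>u\<in>dom_op A \<inter> dom_op H. \<forall>v\<in>dom_op A \<inter> dom_op H.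
          F u v = cinner (app A u) (app H v) - cinner (app H u) (app A v))
     \<and> (\<forall>u v. u \<notin> dom_op H \<or> v \<notin> dom_op H \<longrightarrow> F u v = 0)"
      by (auto simp: commutator_via_Q F_def)
    have F_cont: "continuous_on (op_graph H \<times> op_graph H) (\<lambda>((u, _), (v, _)). F u v)"
      using \<open>graph_continuous_form H F\<close> by (simp add: graph_continuous_form_def)
    fix G
    assume G: "sesquilinear_on (dom_op H) G \<and> graph_continuous_form H G
     \<and> (\<forall>u\<in>dom_op A \<inter> dom_op H. \<forall>v\<in>dom_op A \<inter> dom_op H.
          G u v = cinner (app A u) (app H v) - cinner (app H u) (app A v))
     \<and> (\<forall>u v. u \<notin> dom_op H \<or> v \<notin> dom_op H \<longrightarrow> G u v = 0)"
    then have G_cont: "continuous_on (op_graph H \<times> op_graph H) (\<lambda>((u, _), (v, _)). G u v)"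
      by (simp add: graph_continuous_form_def)
    show "G = F"
    proof (intro ext)
      fix u v
      show "G u v = F u v"
      proof (cases "u \<in> dom_op H \<and> v \<in> dom_op H")
        case True
        then obtain f where f: "\<And>n::nat. f n \<in> dom_op A \<inter> dom_op H"
            "(\<lambda>n. (f n, app H (f n))) \<longlonglongrightarrow> (u, app H u)"
          using graph_dense [of u] by blast
        from True obtain g where g: "\<And>n::nat. g n \<in> dom_op A \<inter> dom_op H"
            "(\<lambda>n. (g n, app H (g n))) \<longlonglongrightarrow> (v, app H v)"
          using graph_dense [of v] by blast
        let ?x = "\<lambda>n. ((f n, app H (f n)), (g n, app H (g n)))"
        have lim: "?x \<longlonglongrightarrow> ((u, app H u), (v, app H v))"
          by (intro tendsto_Pair f(2) g(2))
        have mem: "?x n \<in> op_graph H \<times> op_graph H" for n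
          using f(1) [of n] g(1) [of n] by (auto simp: op_graph_def)
        have mem': "((u, app H u), (v, app H v)) \<in> op_graph H \<times> op_graph H"
          using True by (auto simp: op_graph_def)
        have "(\<lambda>n. F (f n) (g n)) \<longlonglongrightarrow> F u v"
          using continuous_on_tendsto_compose [OF F_cont lim mem'] mem by simp
        moreover have "(\<lambda>n. G (f n) (g n)) \<longlonglongrightarrow> G u v"
          using continuous_on_tendsto_compose [OF G_cont lim mem'] mem by simp
        moreover have "F (f n) (g n) = G (f n) (g n)" for n
          using G f(1) [of n] g(1) [of n] by (simp add: F_def commutator_via_Q)
        ultimately show ?thesis by (simp add: LIMSEQ_unique)
      qed (use G in \<open>auto simp: F_def\<close>)
    qed
  qed
  then show ?thesis using u v by (simp add: F_def)
qed

end

section \<open>The dilation relation and decay\<close>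

locale dilation_pair = C1_pair +
  fixes c :: real
  assumes H_prime: "\<And>v w. v \<in> dom_op H \<Longrightarrow> w \<in> dom_op H \<Longrightarrow>
    H_prime A H v w = complex_of_real c * cinner v (app H w)"
begin

text \<open>\<open>[A, S] = - S [A, H] S\<close> with \<open>[A, H] = \<i>cH\<close>. The difference
  \<open>w\<close> of both sides is orthogonal to the range of \<open>H - cnj z\<close>, so
  self-adjointness gives \<open>Hw = zw\<close>, and injectivity of \<open>H - z\<close> gives
  \<open>w = 0\<close>.\<close>

lemma T_eq:
  assumes y: "y \<in> dom_op A"
  shows "T y = - ((\<i> * complex_of_real c) *\<^sub>C S (app H (S y)))"
proof -
  define w where "w = T y + (\<i> * complex_of_real c) *\<^sub>C S (app H (S y))"
  have "cinner (app H u) w = cinner u (z *\<^sub>C w)" if u: "u \<in> dom_op H" for u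
  proof -
    let ?u' = "app H u - cnj z *\<^sub>C u"
    have "cinner (Q ?u') y = - commutator_form A H u (S y)"
      using commutator_form_eq [OF u S_dom] by (simp add: shift_S)
    also have "\<dots> = - (\<i> * (\<i> * - commutator_form A H u (S y)))"
      by (simp add: mult.assoc [symmetric])
    also have "\<dots> = - (\<i> * complex_of_real c * cinner u (app H (S y)))"
      using H_prime [OF u S_dom] by (simp add: H_prime_def mult.assoc)
    finally have "cinner ?u' (T y) = - (\<i> * complex_of_real c * cinner u (app H (S y)))"
      by (simp add: cinner_Q y)
    then have "cinner ?u' w = 0"
      using cinner_shift_S [OF u, of "app H (S y)"]
      by (simp add: w_def cinner_add_right cinner_scaleC_right)
    then show ?thesis by (simp add: cinner_diff_left cinner_scaleC_left cinner_scaleC_right)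
  qed
  from H.adjoint_domain [OF this] S_shift [of w] have "w = 0"
    by (simp add: bounded_op_zero [OF bounded_op_S])
  then show ?thesis by (simp add: w_def eq_neg_iff_add_eq_0)
qed

text \<open>With \<open>N = (H - z) R\<close> one has \<open>R = S N = N S\<close>, and \<open>N\<close> is an affine function of \<open>R\<close>; this gives
  \<open>[A\<^sub>h, R] = - \<i>k N [A\<^sub>h, S] N\<close> for every bounded operator \<open>A\<^sub>h\<close>.\<close>

lemma res_commutator:
  assumes v: "v \<in> dom_op A"
  shows "H.res k v \<in> dom_op A"
    and "app A (H.res k v) = H.res k (app A v)
      + (\<i> * complex_of_real c) *\<^sub>C (H.res k (H.res k v) - H.res k v)"
proof -
  have "H.res k v \<in> dom_op A \<and> app A (H.res k v) = H.res k (app A v)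
      + (\<i> * complex_of_real c) *\<^sub>C (H.res k (H.res k v) - H.res k v)"
  proof (cases "k = 0")
    case k: False
    define R where "R = H.res k"
    define N where "N y = app H (R y) - z *\<^sub>C R y" for y
    define \<beta> where "\<beta> = 1 / (\<i> * complex_of_real k)"
    have k\<beta>: "\<i> * complex_of_real k * \<beta> = 1" using k by (simp add: \<beta>_def)
    have R: "R (x + y) = R x + R y" "R (x - y) = R x - R y" "R (a *\<^sub>C x) = a *\<^sub>C R x" for x y a
      by (simp_all add: R_def H.res_add H.res_diff H.res_scaleC)
    have HR: "app H (R y) = \<beta> *\<^sub>C (R y - y)" for y
      using k by (simp add: R_def \<beta>_def scaleC_scaleC flip: H.app_res_eq)
    have N_eq: "N y = (\<beta> - z) *\<^sub>C R y - \<beta> *\<^sub>C y" for y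
      by (simp add: N_def HR scaleC_diff_left scaleC_diff_right)
    have SN: "S (N y) = R y" for y
      using k by (simp add: N_def R_def S_shift H.res_dom)
    have NS: "N (S y) = R y" for y
    proof -
      have "N (S y) = R (app H (S y)) - z *\<^sub>C R (S y)"
        unfolding N_def R_def by (simp add: H.app_res S_dom)
      also have "\<dots> = R (app H (S y) - z *\<^sub>C S y)" by (simp add: R)
      finally show ?thesis by (simp only: shift_S)
    qed
    have op_N: "bounded_op N"
    proof (rule bounded_opI [of _ "cmod (\<beta> - z) + cmod \<beta>"])
      show "norm (N y) \<le> (cmod (\<beta> - z) + cmod \<beta>) * norm y" for y
      proof -
        have "norm (N y) \<le> cmod (\<beta> - z) * norm (R y) + cmod \<beta> * norm y"
          using norm_triangle_ineq4 [of "(\<beta> - z) *\<^sub>C R y" "\<beta> *\<^sub>C y"] by (simp add: N_eq)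
        moreover have "cmod (\<beta> - z) * norm (R y) \<le> cmod (\<beta> - z) * norm y"
          by (intro mult_left_mono) (auto simp: R_def H.norm_res_le)
        ultimately show ?thesis by (simp add: distrib_right)
      qed
    next
      show "N (x + y) = N x + N y" for x y
        by (simp add: N_eq R scaleC_add_right)
      show "N (a *\<^sub>C x) = a *\<^sub>C N x" for a x
        by (simp add: N_eq R scaleC_diff_right scaleC_scaleC mult.commute [of a])
    qed
    have comm: "A.yosida h (R y) - R (A.yosida h y)
        = - ((\<i> * complex_of_real k) *\<^sub>C N (A.yosida h (S (N y)) - S (A.yosida h (N y))))" for h y
    proof -
      let ?Y = "A.yosida h"
      have "N (?Y (S (N y)) - S (?Y (N y))) = N (?Y (R y)) - R (?Y (N y))"
        by (simp only: bounded_op_diff [OF op_N] SN NS)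
      \<comment> \<open>Insert \<open>N = (\<beta> - z) R - \<beta>\<close> into
        \<open>N Y R - R Y N\<close>: the terms \<open>R Y R\<close> cancel and
        \<open>- \<beta> [Y, R]\<close> remains.\<close>
      also have "\<dots> = - (\<beta> *\<^sub>C (?Y (R y) - R (?Y y)))"
        unfolding N_eq bounded_op_diff [OF A.bounded_op_yosida]
          bounded_op_scaleC [OF A.bounded_op_yosida] R
        by (simp add: scaleC_diff_right)
      finally show ?thesis using k\<beta> by (simp add: scaleC_scaleC)
    qed
    \<comment> \<open>The right-hand side of \<open>T_eq\<close>, written for every vector by means
      of \<open>H S = 1 + zS\<close>. It is continuous, so the limit can be taken although
      \<open>N v\<close> is not yet known to lie in \<open>dom_op A\<close>.\<close>
    define W where "W y = - ((\<i> * complex_of_real c) *\<^sub>C S (y + z *\<^sub>C S y))" for y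
    have W: "T y = W y" if "y \<in> dom_op A" for y
      using T_eq [OF that] by (simp add: W_def app_S)
    have W_lim: "(\<lambda>n. W (f n)) \<longlonglongrightarrow> W y" if "f \<longlonglongrightarrow> y" for f y
      unfolding W_def by (intro tendsto_intros S_tendsto that)
    have "(\<lambda>n. A.res (\<epsilon> n) (W (A.res (\<epsilon> n) (N v)))) \<longlonglongrightarrow> W (N v)"
      by (rule tendsto_contraction_family [where a = "W (N v)", OF A.res_diff A.norm_res_le])
        (intro W_lim A.res_tendsto_id_compose \<epsilon>)+
    then have "(\<lambda>n. R (A.yosida (\<epsilon> n) v)
          - (\<i> * complex_of_real k) *\<^sub>C N (A.res (\<epsilon> n) (W (A.res (\<epsilon> n) (N v)))))
        \<longlonglongrightarrow> R (app A v) - (\<i> * complex_of_real k) *\<^sub>C N (W (N v))"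
      unfolding R_def
      by (intro tendsto_intros bounded_op_tendsto [OF op_N] H.res_tendsto
          A.yosida_tendsto [OF \<epsilon>(1,2) v])
    moreover have "R (A.yosida (\<epsilon> n) v)
          - (\<i> * complex_of_real k) *\<^sub>C N (A.res (\<epsilon> n) (W (A.res (\<epsilon> n) (N v))))
        = app A (A.res (\<epsilon> n) (R v))" for n
    proof -
      have "A.yosida (\<epsilon> n) (R v) - R (A.yosida (\<epsilon> n) v)
          = - ((\<i> * complex_of_real k) *\<^sub>C N (A.res (\<epsilon> n) (W (A.res (\<epsilon> n) (N v)))))"
        using \<epsilon>(2) [of n] by (simp add: comm yosida_commutator [OF \<epsilon>(2)] W A.res_dom)
      then have "A.yosida (\<epsilon> n) (R v) = R (A.yosida (\<epsilon> n) v)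
          - (\<i> * complex_of_real k) *\<^sub>C N (A.res (\<epsilon> n) (W (A.res (\<epsilon> n) (N v))))"
        by (simp add: diff_eq_eq)
      then show ?thesis by (simp add: A.yosida_eq \<epsilon>(2))
    qed
    ultimately have "(\<lambda>n. app A (A.res (\<epsilon> n) (R v)))
        \<longlonglongrightarrow> R (app A v) - (\<i> * complex_of_real k) *\<^sub>C N (W (N v))"
      by simp
    \<comment> \<open>The vectors \<open>A.res (\<epsilon> n) (R v)\<close> tend to
      \<open>R v\<close> and their images under \<open>A\<close> converge; closedness yields
      membership and value together.\<close>
    from A.closed_op [OF _ A.res_tendsto_id_compose [OF \<epsilon>(1)] this]
    have dom: "R v \<in> dom_op A"
      and app: "app A (R v) = R (app A v) - (\<i> * complex_of_real k) *\<^sub>C N (W (N v))"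
      using \<epsilon>(2) by (simp_all add: A.res_dom)
    have "N (W (N v)) = - ((\<i> * complex_of_real c) *\<^sub>C R (app H (R v)))"
    proof -
      have "W (N v) = - ((\<i> * complex_of_real c) *\<^sub>C S (app H (R v)))"
      proof -
        have "N v + z *\<^sub>C S (N v) = app H (R v)" by (simp only: SN) (simp add: N_def)
        then show ?thesis by (simp only: W_def)
      qed
      then show ?thesis
        using bounded_op_scaleC [OF op_N, of "- (\<i> * complex_of_real c)" "S (app H (R v))"]
        by (simp add: NS)
    qed
    moreover have "(\<i> * complex_of_real k) *\<^sub>C (\<i> * complex_of_real c) *\<^sub>C R (app H (R v))
        = (\<i> * complex_of_real c) *\<^sub>C (R (R v) - R v)"
    proof -
      have "(\<i> * complex_of_real k) *\<^sub>C R (app H (R v)) = R (R v) - R v"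
        using k\<beta> by (simp add: HR R scaleC_scaleC)
      from this [symmetric] show ?thesis by (simp only: scaleC_scaleC mult_ac)
    qed
    ultimately have "app A (R v) = R (app A v) + (\<i> * complex_of_real c) *\<^sub>C (R (R v) - R v)"
      using app by simp
    with dom show ?thesis by (simp add: R_def)
  qed (use v in simp)
  then show "H.res k v \<in> dom_op A" and "app A (H.res k v) = H.res k (app A v)
      + (\<i> * complex_of_real c) *\<^sub>C (H.res k (H.res k v) - H.res k v)" by auto
qed

text \<open>With \<open>R = H.res k\<close>, the commutator \<open>[A, R] = \<i>c (R^2 - R)\<close>
  commutes with \<open>R\<close>, so the Leibniz rule for \<open>R^n\<close> gives \<open>n\<close>
  equal terms.\<close>

lemma res_power_commutator:
  assumes v: "v \<in> dom_op A"
  shows "(H.res k ^^ n) v \<in> dom_op A \<and> app A ((H.res k ^^ n) v) = (H.res k ^^ n) (app A v)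
    + (of_nat n * \<i> * complex_of_real c) *\<^sub>C ((H.res k ^^ Suc n) v - (H.res k ^^ n) v)"
proof (induction n)
  case (Suc n)
  let ?P = "\<lambda>n. H.res k ^^ n"
  have "app A (H.res k (?P n v)) = H.res k (app A (?P n v))
      + (\<i> * complex_of_real c) *\<^sub>C (?P (Suc (Suc n)) v - ?P (Suc n) v)"
    using res_commutator(2) [of "?P n v" k] Suc by simp
  also have "H.res k (app A (?P n v)) = ?P (Suc n) (app A v)
      + (of_nat n * \<i> * complex_of_real c) *\<^sub>C (?P (Suc (Suc n)) v - ?P (Suc n) v)"
    using Suc by (simp add: H.res_add H.res_scaleC H.res_diff)
  finally show ?case
    using Suc by (simp add: res_commutator(1) scaleC_add_left distrib_right add.assoc)
qed (use v in simp)

lemma approx_commutator: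
  assumes v: "v \<in> dom_op A" "v \<in> dom_op H"
  shows "H.approx k t v \<in> dom_op A" and
    "app A (H.approx k t v) = H.approx k t (app A v)
      - complex_of_real (c * t) *\<^sub>C H.approx k t (H.res (t / 2 ^ k) (app H v))"
proof -
  let ?h = "t / 2 ^ k"
  show "H.approx k t v \<in> dom_op A"
    unfolding H.approx_def using res_power_commutator [OF v(1)] by blast
  have "(H.res ?h ^^ Suc (2 ^ k)) v - (H.res ?h ^^ (2 ^ k)) v = H.approx k t (H.res ?h v - v)"
    by (simp add: H.approx_def funpow_swap1
        bounded_op_diff [OF bounded_op_funpow [OF H.bounded_op_res H.norm_res_le]])
  also have "\<dots> = (\<i> * complex_of_real ?h) *\<^sub>C H.approx k t (H.res ?h (app H v))"
    by (simp only: H.res_minus_id [OF v(2)] bounded_op_scaleC [OF H.bounded_op_approx])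
  finally have "app A (H.approx k t v) = H.approx k t (app A v) +
      (of_nat (2 ^ k) * \<i> * complex_of_real c) *\<^sub>C
        (\<i> * complex_of_real ?h) *\<^sub>C H.approx k t (H.res ?h (app H v))"
    using res_power_commutator [OF v(1), where k = ?h and n = "2 ^ k"] by (simp add: H.approx_def)
  \<comment> \<open>The number of steps cancels the step size, and the two factors
    \<open>\<i>\<close> give the minus sign.\<close>
  moreover have "of_nat (2 ^ k) * \<i> * complex_of_real c * (\<i> * complex_of_real ?h)
      = - complex_of_real (c * t)"
    by (simp add: field_simps)
  ultimately show "app A (H.approx k t v) = H.approx k t (app A v)
      - complex_of_real (c * t) *\<^sub>C H.approx k t (H.res ?h (app H v))"
    by (simp only: scaleC_scaleC scaleC_minus_left) simp
qed

text \<open>Stated weakly: with \<open>A\<close> moved to the fixed vector \<open>u\<close>, the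
  identity for the approximants passes to the limit term by term.\<close>

lemma grp_commutator:
  assumes u: "u \<in> dom_op A" and v: "v \<in> dom_op A" "v \<in> dom_op H"
  shows "cinner (app A u) (H.grp t v) = cinner u (H.grp t (app A v))
    - complex_of_real (c * t) * cinner u (H.grp t (app H v))"
proof -
  have "(\<lambda>k. t / 2 ^ k) \<longlonglongrightarrow> 0" by (rule LIMSEQ_divide_realpow_zero) simp
  then have "(\<lambda>k. H.res (t / 2 ^ k) (app H v)) \<longlonglongrightarrow> app H v"
    by (rule H.res_tendsto_id_compose)
  then have "(\<lambda>k. H.approx k t (H.res (t / 2 ^ k) (app H v))) \<longlonglongrightarrow> H.grp t (app H v)"
    by (rule tendsto_contraction_family [OF bounded_op_diff [OF H.bounded_op_approx] H.norm_approx_le _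
          H.approx_lim])
  then have "(\<lambda>k. cinner u (H.approx k t (app A v))
        - complex_of_real (c * t) * cinner u (H.approx k t (H.res (t / 2 ^ k) (app H v))))
      \<longlonglongrightarrow> cinner u (H.grp t (app A v)) - complex_of_real (c * t) * cinner u (H.grp t (app H v))"
    by (intro tendsto_intros H.approx_lim)
  moreover have "(\<lambda>k. cinner (app A u) (H.approx k t v)) \<longlonglongrightarrow> cinner (app A u) (H.grp t v)"
    by (intro tendsto_intros H.approx_lim)
  moreover have "cinner (app A u) (H.approx k t v) = cinner u (H.approx k t (app A v))
      - complex_of_real (c * t) * cinner u (H.approx k t (H.res (t / 2 ^ k) (app H v)))" for k
    using A.symmetric [OF u approx_commutator(1) [OF v, of k t]]
    by (simp add: approx_commutator(2) [OF v] cinner_diff_right cinner_scaleC_right)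
  ultimately show ?thesis by (simp add: LIMSEQ_unique)
qed

text \<open>A majorant of the derivative of \<open>s |\<psi>(s)|^2\<close>. It comes from
  \<open>|\<psi>|^2 + 2 |\<psi>| |s\<psi>'| \<le> 2 |\<psi>|^2 + |s\<psi>'|^2\<close>, where
  \<open>|s\<psi>'| = |a - b| / |c|\<close> for the two correlations \<open>a\<close>,
  \<open>b\<close> of \<open>v\<close> with \<open>Av\<close>, and from
  \<open>|a - b|^2 \<le> 2 (|a|^2 + |b|^2)\<close>.\<close>

definition energy :: "'a \<Rightarrow> real \<Rightarrow> real" where
  "energy v s = 2 * (cmod (cinner v (H.grp s v)))\<^sup>2 + 2 / c\<^sup>2 *
    ((cmod (cinner (app A v) (H.grp s v)))\<^sup>2 + (cmod (cinner v (H.grp s (app A v))))\<^sup>2)"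

lemma continuous_on_energy: "continuous_on X (energy v)"
  unfolding energy_def by (intro continuous_intros H.continuous_on_cinner_grp)

lemma energy_nonneg: "0 \<le> energy v s"
  by (simp add: energy_def)

lemma energy_estimate_core:
  assumes c: "c \<noteq> 0" and v: "v \<in> dom_op A" "v \<in> dom_op H" and t: "t \<ge> 0"
  shows "t * (cmod (cinner v (H.grp t v)))\<^sup>2 \<le> integral {0..t} (energy v)"
proof -
  define \<psi> where "\<psi> s = cinner v (H.grp s v)" for s
  define d where "d s = \<i> * cinner v (H.grp s (app H v))" for s
  define e where "e s = inner (\<psi> s) (\<psi> s) + s * (2 * inner (\<psi> s) (d s))" for s
  have \<psi>': "(\<psi> has_vector_derivative d s) (at s)" for s
    using bounded_linear.has_vector_derivative [OF
        bounded_bilinear.bounded_linear_right [OF bounded_bilinear_cinner, of v]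
        H.has_vector_derivative_grp [OF v(2), of s]]
    by (simp add: \<psi>_def [abs_def] d_def cinner_scaleC_right)
  have "((\<lambda>s. s * inner (\<psi> s) (\<psi> s)) has_vector_derivative e s) (at s)" for s
  proof -
    have "((\<lambda>s. inner (\<psi> s) (\<psi> s)) has_vector_derivative inner (\<psi> s) (d s) + inner (d s) (\<psi> s)) (at s)"
      by (rule bounded_bilinear.has_vector_derivative [OF bounded_bilinear_inner \<psi>' \<psi>'])
    from bounded_bilinear.has_vector_derivative [OF bounded_bilinear_mult
        has_vector_derivative_id this]
    show ?thesis by (simp add: e_def inner_commute algebra_simps)
  qed
  then have ftc: "(e has_integral t * inner (\<psi> t) (\<psi> t) - 0 * inner (\<psi> 0) (\<psi> 0)) {0..t}"
    using t by (intro fundamental_theorem_of_calculus) (auto intro: has_vector_derivative_at_within)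
  have "e s \<le> energy v s" for s
  proof -
    define a b where "a = cinner (app A v) (H.grp s v)" and "b = cinner v (H.grp s (app A v))"
    have "a - b = - (complex_of_real (c * s) * cinner v (H.grp s (app H v)))"
      using grp_commutator [OF v(1) v, of s] by (simp add: a_def b_def)
    \<comment> \<open>The factor \<open>s\<close> of the commutator formula is exactly the one in
      \<open>s \<psi>'(s)\<close>; the vector \<open>Hv\<close> leaves the estimate here.\<close>
    then have sd: "\<bar>s\<bar> * cmod (d s) = cmod (a - b) / \<bar>c\<bar>"
      using c by (simp add: d_def norm_mult)
    have "s * (2 * inner (\<psi> s) (d s)) \<le> 2 * (cmod (\<psi> s) * (\<bar>s\<bar> * cmod (d s)))"
    proof -
      have "s * inner (\<psi> s) (d s) \<le> \<bar>s\<bar> * \<bar>inner (\<psi> s) (d s)\<bar>"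
        by (metis abs_ge_self abs_mult)
      also have "\<dots> \<le> \<bar>s\<bar> * (cmod (\<psi> s) * cmod (d s))"
        by (intro mult_left_mono Cauchy_Schwarz_ineq2) auto
      finally show ?thesis by (simp add: mult_ac)
    qed
    also have "\<dots> = 2 * cmod (\<psi> s) * (cmod (a - b) / \<bar>c\<bar>)" by (simp add: sd)
    also have "\<dots> \<le> (cmod (\<psi> s))\<^sup>2 + (cmod (a - b) / \<bar>c\<bar>)\<^sup>2"
      by (rule sum_squares_bound)
    also have "(cmod (a - b) / \<bar>c\<bar>)\<^sup>2 = (cmod (a - b))\<^sup>2 / c\<^sup>2"
      by (simp add: power_divide)
    also have "(cmod (a - b))\<^sup>2 / c\<^sup>2 \<le> (2 * ((cmod a)\<^sup>2 + (cmod b)\<^sup>2)) / c\<^sup>2"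
    proof (rule divide_right_mono)
      have "(cmod (a - b))\<^sup>2 \<le> (cmod a + cmod b)\<^sup>2"
        by (intro power_mono norm_triangle_ineq4) auto
      also have "\<dots> \<le> 2 * ((cmod a)\<^sup>2 + (cmod b)\<^sup>2)"
        using sum_squares_bound [of "cmod a" "cmod b"] by (simp add: power2_sum)
      finally show "(cmod (a - b))\<^sup>2 \<le> 2 * ((cmod a)\<^sup>2 + (cmod b)\<^sup>2)" .
    qed simp
    finally show ?thesis
      by (simp add: e_def energy_def \<psi>_def a_def b_def power2_norm_eq_inner)
  qed
  moreover have "(energy v has_integral integral {0..t} (energy v)) {0..t}"
    by (intro integrable_integral integrable_continuous_interval continuous_on_energy)
  ultimately have "t * inner (\<psi> t) (\<psi> t) - 0 * inner (\<psi> 0) (\<psi> 0) \<le> integral {0..t} (energy v)"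
    using has_integral_le [OF ftc] by blast
  then show ?thesis by (simp add: \<psi>_def power2_norm_eq_inner)
qed

text \<open>The vectors \<open>(1 - \<i>hH)^-1 u\<close> lie in both domains, and
  \<open>res_commutator\<close> shows that their images under \<open>A\<close> tend to
  \<open>Au\<close>. As \<open>energy\<close> contains \<open>Av\<close> but not \<open>Hv\<close>,
  both sides of the estimate converge.\<close>

lemma energy_estimate:
  assumes c: "c \<noteq> 0" and u: "u \<in> dom_op A" and t: "t \<ge> 0"
  shows "t * (cmod (cinner u (H.grp t u)))\<^sup>2 \<le> integral {0..t} (energy u)"
proof -
  define v where "v n = H.res (\<epsilon> n) u" for n
  have v_dom: "v n \<in> dom_op A" "v n \<in> dom_op H" for n
    using \<epsilon>(2) by (simp_all add: v_def res_commutator(1) u H.res_dom)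
  have v_lim: "v \<longlonglongrightarrow> u"
    unfolding v_def by (intro H.res_tendsto_id_compose \<epsilon>)
  have "(\<lambda>n. H.res (\<epsilon> n) (v n)) \<longlonglongrightarrow> u"
    by (rule tendsto_contraction_family [OF H.res_diff H.norm_res_le v_lim]) (intro H.res_tendsto_id_compose \<epsilon>)
  then have "(\<lambda>n. H.res (\<epsilon> n) (app A u) + (\<i> * complex_of_real c) *\<^sub>C (H.res (\<epsilon> n) (v n) - v n))
      \<longlonglongrightarrow> app A u + (\<i> * complex_of_real c) *\<^sub>C (u - u)"
    by (intro tendsto_intros H.res_tendsto_id_compose \<epsilon> v_lim)
  then have Av_lim: "(\<lambda>n. app A (v n)) \<longlonglongrightarrow> app A u"
    by (simp add: v_def res_commutator(2) [OF u])
  have E_lim: "(\<lambda>n. energy (v n) s) \<longlonglongrightarrow> energy u s" for s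
    unfolding energy_def by (intro tendsto_intros H.grp_tendsto v_lim Av_lim)
  \<comment> \<open>The Cauchy-Schwarz majorant of \<open>energy (v n)\<close>. It is independent of
    time and converges in \<open>n\<close>, hence is bounded, which supplies the constant for
    dominated convergence.\<close>
  have "(\<lambda>n. 2 * (norm (v n) * norm (v n))\<^sup>2 + 2 / c\<^sup>2 *
        ((norm (app A (v n)) * norm (v n))\<^sup>2 + (norm (v n) * norm (app A (v n)))\<^sup>2))
      \<longlonglongrightarrow> 2 * (norm u * norm u)\<^sup>2 + 2 / c\<^sup>2 *
        ((norm (app A u) * norm u)\<^sup>2 + (norm u * norm (app A u))\<^sup>2)"
    by (intro tendsto_intros v_lim Av_lim)
  from convergent_imp_Bseq [OF convergentI [OF this]] obtain K where K: "\<And>n. \<bar>2 * (norm (v n) * norm (v n))\<^sup>2 + 2 / c\<^sup>2 *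
      ((norm (app A (v n)) * norm (v n))\<^sup>2 + (norm (v n) * norm (app A (v n)))\<^sup>2)\<bar> \<le> K"
    by (auto simp: Bseq_def)
  have le: "(cmod (cinner x (H.grp s y)))\<^sup>2 \<le> (norm x * norm y)\<^sup>2" for x y s
    using order_trans [OF cmod_cinner_le mult_left_mono [OF H.norm_grp_le norm_ge_zero]]
    by (intro power_mono) auto
  have E_le: "norm (energy (v n) s) \<le> K" for n s
  proof -
    have "energy (v n) s \<le> 2 * (norm (v n) * norm (v n))\<^sup>2 + 2 / c\<^sup>2 *
        ((norm (app A (v n)) * norm (v n))\<^sup>2 + (norm (v n) * norm (app A (v n)))\<^sup>2)"
      unfolding energy_def by (intro add_mono mult_left_mono le) auto
    then show ?thesis using K [of n] energy_nonneg [of "v n" s] by simp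
  qed
  have "(\<lambda>n. integral {0..t} (energy (v n))) \<longlonglongrightarrow> integral {0..t} (energy u)"
    by (rule dominated_convergence(2) [of _ _ "\<lambda>_. K"])
      (auto intro!: integrable_continuous_interval continuous_on_energy E_lim E_le [simplified])
  moreover have "(\<lambda>n. t * (cmod (cinner (v n) (H.grp t (v n))))\<^sup>2) \<longlonglongrightarrow> t * (cmod (cinner u (H.grp t u)))\<^sup>2"
    by (intro tendsto_intros H.grp_tendsto v_lim)
  ultimately show ?thesis
    using energy_estimate_core [OF c v_dom t] by (intro LIMSEQ_le) auto
qed

lemma energy_bound:
  assumes u: "u \<in> E_space H" "app A u \<in> E_space H"
  shows "\<exists>M. \<forall>t>0. integral {0..t} (energy u) \<le> M"
proof -
  let ?q = "\<lambda>f g t. (cmod (cinner f (H.grp t g)))\<^sup>2"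
  obtain M1 M2 M3 where M:
    "\<And>t. t > 0 \<Longrightarrow> integral {0..t} (?q u u) \<le> M1"
    "\<And>t. t > 0 \<Longrightarrow> integral {0..t} (?q (app A u) u) \<le> M2"
    "\<And>t. t > 0 \<Longrightarrow> integral {0..t} (?q u (app A u)) \<le> M3"
    using H.cross_correlation_bound u by metis
  have int: "?q f g integrable_on {0..t}" for f g t
    by (intro integrable_continuous_interval H.continuous_on_cinner_grp)
  have "integral {0..t} (energy u) \<le> 2 * M1 + 2 / c\<^sup>2 * (M2 + M3)" if t: "t > 0" for t
  proof -
    have "integral {0..t} (energy u) = 2 * integral {0..t} (?q u u)
        + 2 / c\<^sup>2 * (integral {0..t} (?q (app A u) u) + integral {0..t} (?q u (app A u)))"
      unfolding energy_def [abs_def]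
      by (simp only: integral_add int integrable_on_mult_right integrable_add integral_mult_right)
    also have "\<dots> \<le> 2 * M1 + 2 / c\<^sup>2 * (M2 + M3)"
      by (intro add_mono mult_left_mono M t) auto
    finally show ?thesis .
  qed
  then show ?thesis by blast
qed

end

theorem proposition4p7:
  fixes A H :: "'a::complex_hilbert unbounded_op" and c :: real and u :: 'a
  assumes "self_adjoint A" and "self_adjoint H"
    and "C1_self_adjoint A H"
    and "c \<noteq> 0"
    and "\<forall>v\<in>dom_op H. \<forall>w\<in>dom_op H. H_prime A H v w = complex_of_real c * cinner v (app H w)"
    and "u \<in> dom_op A" and "u \<in> E_space H" and "app A u \<in> E_space H"
  shows "\<exists>C::real. \<forall>t::real. cmod (psi H u t) \<le> C * japanese_bracket t powr (- (1/2))"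
proof -
  obtain z where "z \<in> resolvent_set H" "C1_bounded A (resolvent H z)"
    using assms(3) by (auto simp: C1_self_adjoint_def)
  then interpret dilation_pair A H z c
    using assms(1,2,5) by unfold_locales auto
  obtain M where M: "\<And>t. t > 0 \<Longrightarrow> integral {0..t} (energy u) \<le> M"
    using energy_bound [OF assms(7,8)] by blast
  \<comment> \<open>The first summand controls \<open>\<bar>t\<bar> |\<psi>|^2\<close>, the second
    controls \<open>|\<psi>|^2\<close> itself, also near \<open>t = 0\<close>; together they control
    \<open>(1 + \<bar>t\<bar>) |\<psi>|^2\<close>, and \<open>1 + \<bar>t\<bar>\<close> dominates
    the bracket.\<close>
  define D where "D = \<bar>M\<bar> + (norm u * norm u)\<^sup>2"
  have "cmod (psi H u t) \<le> sqrt D * japanese_bracket t powr (- (1/2))" for t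
  proof -
    let ?p = "(cmod (cinner u (H.grp t u)))\<^sup>2"
    have abs: "\<bar>t\<bar> * ?p \<le> \<bar>M\<bar>"
    proof (cases "t = 0")
      case False
      \<comment> \<open>Negative times reduce to positive ones because the modulus of
        \<open>\<psi>\<close> is even.\<close>
      have "cmod (cinner u (H.grp \<bar>t\<bar> u)) = cmod (cinner u (H.grp t u))"
        by (simp add: abs_if H.cmod_psi_minus)
      then show ?thesis
        using energy_estimate [OF assms(4,6), of "\<bar>t\<bar>"] M [of "\<bar>t\<bar>"] False by simp
    qed simp
    have "cmod (cinner u (H.grp t u)) \<le> norm u * norm u"
      using order_trans [OF cmod_cinner_le mult_left_mono [OF H.norm_grp_le norm_ge_zero]] .
    then have "?p \<le> (norm u * norm u)\<^sup>2" by (intro power_mono) auto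
    then have D: "(1 + \<bar>t\<bar>) * ?p \<le> D" 
      using abs unfolding D_def distrib_right mult_1 by linarith
    have pos: "1 + t\<^sup>2 > 0" by (simp add: add_pos_nonneg)
    have J: "japanese_bracket t = sqrt (1 + t\<^sup>2)"
      using pos by (simp add: japanese_bracket_def powr_half_sqrt)
    have "sqrt (1 + t\<^sup>2) \<le> 1 + \<bar>t\<bar>"
      by (rule real_le_lsqrt) (auto simp: power2_sum)
    then have "sqrt (1 + t\<^sup>2) * ?p \<le> D"
      using D mult_right_mono [of "sqrt (1 + t\<^sup>2)" "1 + \<bar>t\<bar>" ?p] by simp
    then have "sqrt (sqrt (1 + t\<^sup>2)) * cmod (cinner u (H.grp t u)) \<le> sqrt D"
      using real_sqrt_le_mono by (fastforce simp: real_sqrt_mult)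
    moreover have "japanese_bracket t powr (- (1/2)) = 1 / sqrt (sqrt (1 + t\<^sup>2))"
      using pos by (simp add: J powr_minus powr_half_sqrt inverse_eq_divide)
    moreover have "sqrt (sqrt (1 + t\<^sup>2)) > 0" using pos by simp
    ultimately show ?thesis
      by (simp add: H.psi_eq pos_le_divide_eq mult.commute)
  qed
  then show ?thesis by blast
qed

end
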